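(* Let $(K(I\mathbb P(1,2))_{\mathbb Q},\star,1=\chi_0^0)$ be the virtual K-theory ring. There are two isomorphisms of $\mathbb Q$-algebras (and $\psi$-rings), one for each choice of sign, $$\Phi_\pm\colon\frac{\mathbb Q[\sigma,\tau]}{\langle(\tau-1)(\tau^2-1),\ (\sigma-1)(\sigma^2-1),\ (\sigma-\tau)(\tau-1)\rangle}\longrightarrow K(I\mathbb P(1,2))_{\mathbb Q},$$ with $\Phi_\pm(\sigma)=\chi_0^1$ and $\Phi_\pm(\tau)=\frac12(\chi_0^0+\chi_0^1\pm\chi_1^0)$; here the $\psi$-ring structure on the domain is given by $\psi^\ell(\sigma^{\pm1})=\sigma^{\pm\ell}$ and $\psi^\ell(\tau^{\pm1})=\tau^{\pm\ell}$ for all $\ell\ge1$. Similarly, there are two isomorphisms of graded $\mathbb Q$-algebras $$\Psi_\pm\colon\frac{\mathbb Q[\mu,\nu]}{\langle\mu,\nu\rangle^2}\longrightarrow A^*(I\mathbb P(1,2))_{\mathbb Q}$$ (onto the rational virtual Chow ring, with $\mu,\nu$ of degree $1$), with $\Psi_\pm(\nu)=\widetilde c^{\,1}\big(\tfrac12(\chi_0^0+\chi_0^1\pm\chi_1^0)\big)=\frac12(c_0^1\pm c_1^0)$ and $\Psi_\pm(\mu)=\widetilde c^{\,1}(\chi_0^1)=c_0^1$. Under the identifications $\Phi_\pm$ and $\Psi_\pm$, the inertial Chern character $\widetilde{\mathrm{Ch}}\colon K(I\mathbb P(1,2))_{\mathbb Q}\to A^*(I\mathbb P(1,2))_{\mathbb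 Q}$ corresponds to the map $\sigma\mapsto\exp(\mu)=1+\mu$ and $\tau\mapsto\exp(\nu)=1+\nu$.
   Context: $X=\mathbb C^2\smallsetminus\{0\}$ with $\mathbb C^\times$ acting by $t\cdot(a,b)=(ta,t^2b)$; $\mathbb P(1,2)=[X/\mathbb C^\times]$. $X^0=X$ and $X^1=\{(0,b):b\ne0\}$ is the fixed locus of $-1$; $I\mathbb P(1,2)=[(X^0\sqcup X^1)/\mathbb C^\times]$. For $m=0,1$ let $\chi_m\in K_{\mathbb C^\times}(X^m)$ be the class of the line bundle of the defining character and $c_m=c_1(\chi_m)\in A^1_{\mathbb C^\times}(X^m)$. With classical products, $K_{\mathbb C^\times}(X^0)=\mathbb Z[\chi_0]/\langle(\chi_0-1)(\chi_0^2-1)\rangle$, $K_{\mathbb C^\times}(X^1)=\mathbb Z[\chi_1]/\langle\chi_1^2-1\rangle$, $A^*_{\mathbb C^\times}(X^0)=\mathbb Z[c_0]/\langle2c_0^2\rangle$, $A^*_{\mathbb C^\times}(X^1)=\mathbb Z[c_1]/\langle2c_1\rangle$; $K(I\mathbb P(1,2))$ and $A^*(I\mathbb P(1,2))$ are the direct sums over $m$. $\chi_m^a$, $c_m^a$ denote classical powers ($c_m^0=[X^m]$; the subscript is the sector, the superscript the exponent); subscript $\mathbb Q$ means $\otimes\mathbb Q$. The virtual product $\star$ is the inertial product for the pair with $\mathscr S$ the normal bundle of $X^0\sqcup X^1\to X$ ($\mathscr S|_{X^0}=0$, $\mathscr S|_{X^1}=\chi_1$). Explicitly: $\chi_0^a\star\chi_m^b=\chi_m^{a+b}$,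 $\chi_1^a\star\chi_1^b=\chi_0^{a+b}(1-\chi_0^{-1})^2$; $c_0^a\star c_m^b=c_m^{a+b}$, $c_1^a\star c_1^b=c_0^{a+b+2}$. The units are $\chi_0^0$ and $c_0^0$. Virtual degrees in $A^*(I\mathbb P(1,2))_{\mathbb Q}$: $c_0^0$ has degree $0$; $c_0^1$ and $c_1^0$ have degree $1$. Inertial Adams operations: $\widetilde\psi^\ell(\chi_0^a)=\chi_0^{\ell a}$, $\widetilde\psi^\ell(\chi_1^a)=\chi_1^{\ell a}\sum_{i=0}^{\ell-1}\chi_1^{-i}$. Inertial Chern character: $\widetilde{\mathrm{Ch}}(\chi_0^a)=c_0^0+a\,c_0^1$, $\widetilde{\mathrm{Ch}}(\chi_1^a)=c_1^0$; $\widetilde c^{\,1}$ is the virtual degree-$1$ component of $\widetilde{\mathrm{Ch}}$. A $\psi$-ring is a commutative unital ring with ring endomorphisms $\psi^\ell$, $\ell\ge1$, satisfying $\psi^1=\mathrm{id}$, $\psi^k\psi^\ell=\psi^{k\ell}$. *)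

theory Defs
  imports
    "HOL-Algebra.QuotRing"
    "HOL-Algebra.Ideal_Product"
    "HOL-Algebra.Module"
    "HOL-Computational_Algebra.Polynomial"
begin

section \<open>Algebras over the rationals\<close>

definition rat_field :: "rat ring" where
  "rat_field = \<lparr>carrier = UNIV, monoid.mult = (*), one = 1, zero = 0, add = (+)\<rparr>"

definition alg_hom :: "(rat, 'a) module \<Rightarrow> (rat, 'b) module \<Rightarrow> ('a \<Rightarrow> 'b) set" where
  "alg_hom A B = {h \<in> ring_hom A B.
     \<forall>r. \<forall>x\<in>carrier A. h (r \<odot>\<^bsub>A\<^esub> x) = r \<odot>\<^bsub>B\<^esub> h x}"

definition alg_iso :: "(rat, 'a) module \<Rightarrow> (rat, 'b) module \<Rightarrow> ('a \<Rightarrow> 'b) \<Rightarrow> bool" where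
  "alg_iso A B h \<longleftrightarrow> algebra rat_field A \<and> algebra rat_field B \<and>
     h \<in> alg_hom A B \<and> bij_betw h (carrier A) (carrier B)"

definition quot_alg :: "(rat, 'a) module \<Rightarrow> 'a set \<Rightarrow> (rat, 'a set) module" where
  "quot_alg A I = ring.extend (A Quot I)
     (module.fields (\<lambda>r X. \<Union>x\<in>X. I +>\<^bsub>A\<^esub> (r \<odot>\<^bsub>A\<^esub> x)))"

definition alg_sum :: "(rat, 'a) module \<Rightarrow> (rat, 'b) module \<Rightarrow> (rat, 'a \<times> 'b) module" where
  "alg_sum A B =
     \<lparr>carrier = carrier A \<times> carrier B,
      monoid.mult = (\<lambda>x y. (fst x \<otimes>\<^bsub>A\<^esub> fst y, snd x \<otimes>\<^bsub>B\<^esub> snd y)),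
      one = (\<one>\<^bsub>A\<^esub>, \<one>\<^bsub>B\<^esub>),
      zero = (\<zero>\<^bsub>A\<^esub>, \<zero>\<^bsub>B\<^esub>),
      add = (\<lambda>x y. (fst x \<oplus>\<^bsub>A\<^esub> fst y, snd x \<oplus>\<^bsub>B\<^esub> snd y)),
      module.smult = (\<lambda>r x. (r \<odot>\<^bsub>A\<^esub> fst x, r \<odot>\<^bsub>B\<^esub> snd x))\<rparr>"

text \<open>Exponential of a nilpotent element; the index set is finite exactly then.\<close>

definition alg_exp :: "(rat, 'a) module \<Rightarrow> 'a \<Rightarrow> 'a" where
  "alg_exp A x = (\<Oplus>\<^bsub>A\<^esub>n\<in>{n::nat. x [^]\<^bsub>A\<^esub> n \<noteq> \<zero>\<^bsub>A\<^esub>}. (1 / fact n) \<odot>\<^bsub>A\<^esub> (x [^]\<^bsub>A\<^esub> n))"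

subsection \<open>Gradings\<close>

definition homogeneous_decomp ::
    "(rat, 'a) module \<Rightarrow> (nat \<Rightarrow> 'a set) \<Rightarrow> 'a \<Rightarrow> (nat \<Rightarrow> 'a) \<Rightarrow> bool" where
  "homogeneous_decomp A G x f \<longleftrightarrow>
     (\<forall>d. f d \<in> G d) \<and> finite {d. f d \<noteq> \<zero>\<^bsub>A\<^esub>} \<and> x = (\<Oplus>\<^bsub>A\<^esub>d\<in>{d. f d \<noteq> \<zero>\<^bsub>A\<^esub>}. f d)"

definition graded_algebra :: "(rat, 'a) module \<Rightarrow> (nat \<Rightarrow> 'a set) \<Rightarrow> bool" where
  "graded_algebra A G \<longleftrightarrow> algebra rat_field A \<and>
     (\<forall>d. submodule (G d) rat_field A) \<and>
     (\<forall>d e. \<forall>x\<in>G d. \<forall>y\<in>G e. x \<otimes>\<^bsub>A\<^esub> y \<in> G (d + e)) \<and>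
     (\<forall>x\<in>carrier A. \<exists>!f. homogeneous_decomp A G x f)"

definition degree_part :: "(rat, 'a) module \<Rightarrow> (nat \<Rightarrow> 'a set) \<Rightarrow> nat \<Rightarrow> 'a \<Rightarrow> 'a" where
  "degree_part A G d x = (THE f. homogeneous_decomp A G x f) d"

definition graded_alg_iso ::
    "(rat, 'a) module \<Rightarrow> (nat \<Rightarrow> 'a set) \<Rightarrow> (rat, 'b) module \<Rightarrow> (nat \<Rightarrow> 'b set) \<Rightarrow> ('a \<Rightarrow> 'b) \<Rightarrow> bool"
  where
  "graded_alg_iso A G B H h \<longleftrightarrow> graded_algebra A G \<and> graded_algebra B H \<and> alg_iso A B h \<and>
     (\<forall>d. h ` G d = H d)"

subsection \<open>\<open>\<psi>\<close>-rings\<close>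

text \<open>Only the operations of index at least 1 are relevant; the value at index 0 is junk.\<close>

definition psi_ring :: "('a, 'm) ring_scheme \<Rightarrow> (nat \<Rightarrow> 'a \<Rightarrow> 'a) \<Rightarrow> bool" where
  "psi_ring R \<psi> \<longleftrightarrow> cring R \<and> (\<forall>l\<ge>1. \<psi> l \<in> ring_hom R R) \<and>
     (\<forall>x\<in>carrier R. \<psi> 1 x = x) \<and>
     (\<forall>k\<ge>1. \<forall>l\<ge>1. \<forall>x\<in>carrier R. \<psi> k (\<psi> l x) = \<psi> (k * l) x)"

definition psi_ring_iso ::
    "('a, 'm) ring_scheme \<Rightarrow> (nat \<Rightarrow> 'a \<Rightarrow> 'a) \<Rightarrow> ('b, 'n) ring_scheme \<Rightarrow> (nat \<Rightarrow> 'b \<Rightarrow> 'b) \<Rightarrow>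
     ('a \<Rightarrow> 'b) \<Rightarrow> bool" where
  "psi_ring_iso R \<psi> S \<phi> h \<longleftrightarrow> psi_ring R \<psi> \<and> psi_ring S \<phi> \<and> h \<in> ring_iso R S \<and>
     (\<forall>l\<ge>1. \<forall>x\<in>carrier R. h (\<psi> l x) = \<phi> l (h x))"

section \<open>Sectors\<close>

definition Qx :: "(rat, rat poly) module" where
  "Qx = \<lparr>carrier = UNIV, monoid.mult = (*), one = 1, zero = 0, add = (+), module.smult = Polynomial.smult\<rparr>"

abbreviation X :: "rat poly" where "X \<equiv> [:0, 1:]"

text \<open>
  A sector ring is an integral presentation \<open>\<int>[x]/\<langle>f\<rangle>\<close> tensored with the rationals, that is
  (right exactness) the same presentation read over the rationals.
\<close>

definition sector :: "rat poly \<Rightarrow> (rat, rat poly set) module" where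
  "sector f = quot_alg Qx (Idl\<^bsub>Qx\<^esub> {f})"

definition sector_gen :: "rat poly \<Rightarrow> rat poly set" where
  "sector_gen f = (Idl\<^bsub>Qx\<^esub> {f}) +>\<^bsub>Qx\<^esub> X"

text \<open>
  Linear extension to a sector of an assignment \<open>x\<^sup>a \<mapsto> g a\<close> on monomials: apply it to a
  polynomial representing the coset. This is meaningful when the result does not depend on the
  representative, i.e. when the assignment respects the relation. Nonnegative exponents
  suffice, because in K-theory the inverse of the generator is a polynomial in it.
\<close>

definition lin_ext :: "(rat, 'b) module \<Rightarrow> (nat \<Rightarrow> 'b) \<Rightarrow> rat poly set \<Rightarrow> 'b" where
  "lin_ext N g A =
     the_elem ((\<lambda>p. \<Oplus>\<^bsub>N\<^esub>a\<in>{..degree p}. coeff p a \<odot>\<^bsub>N\<^esub> g a) ` A)"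

definition bilin_ext ::
    "(rat, 'b) module \<Rightarrow> (nat \<Rightarrow> nat \<Rightarrow> 'b) \<Rightarrow> rat poly set \<Rightarrow> rat poly set \<Rightarrow> 'b" where
  "bilin_ext N g A B = lin_ext N (\<lambda>a. lin_ext N (g a) B) A"

section \<open>Virtual K-theory\<close>

definition K0 :: "(rat, rat poly set) module" where
  "K0 = sector ((X - 1) * (X ^ 2 - 1))"

definition K1 :: "(rat, rat poly set) module" where
  "K1 = sector (X ^ 2 - 1)"

definition x0 :: "rat poly set" where
  "x0 = sector_gen ((X - 1) * (X ^ 2 - 1))"

definition x1 :: "rat poly set" where
  "x1 = sector_gen (X ^ 2 - 1)"

definition K_classical :: "(rat, rat poly set \<times> rat poly set) module" where
  "K_classical = alg_sum K0 K1"

definition chi0 :: "int \<Rightarrow> rat poly set \<times> rat poly set" where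
  "chi0 a = (x0 [^]\<^bsub>K0\<^esub> a, \<zero>\<^bsub>K1\<^esub>)"

definition chi1 :: "int \<Rightarrow> rat poly set \<times> rat poly set" where
  "chi1 a = (\<zero>\<^bsub>K0\<^esub>, x1 [^]\<^bsub>K1\<^esub> a)"

text \<open>
  In the product of two twisted classes, one factor \<open>1 - \<chi>\<^sub>0\<^sup>-\<^sup>1\<close> comes from pushing forward along
  \<open>X\<^sup>1 \<rightarrow> X\<close>, the other is the Euler class of the obstruction bundle.
\<close>

definition K_star ::
    "rat poly set \<times> rat poly set \<Rightarrow> rat poly set \<times> rat poly set \<Rightarrow> rat poly set \<times> rat poly set"
  where
  "K_star u v =
     bilin_ext K_classical (\<lambda>a b. chi0 (int (a + b))) (fst u) (fst v)
     \<oplus>\<^bsub>K_classical\<^esub> bilin_ext K_classical (\<lambda>a b. chi1 (int (a + b))) (fst u) (snd v)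
     \<oplus>\<^bsub>K_classical\<^esub> bilin_ext K_classical (\<lambda>a b. chi1 (int (a + b))) (snd u) (fst v)
     \<oplus>\<^bsub>K_classical\<^esub> bilin_ext K_classical
       (\<lambda>a b. (x0 [^]\<^bsub>K0\<^esub> (a + b) \<otimes>\<^bsub>K0\<^esub> (\<one>\<^bsub>K0\<^esub> \<ominus>\<^bsub>K0\<^esub> x0 [^]\<^bsub>K0\<^esub> (- 1 :: int)) [^]\<^bsub>K0\<^esub> (2::nat),
               \<zero>\<^bsub>K1\<^esub>)) (snd u) (snd v)"

definition K_virt :: "(rat, rat poly set \<times> rat poly set) module" where
  "K_virt = K_classical\<lparr>monoid.mult := K_star, one := chi0 0\<rparr>"

definition K_adams :: "nat \<Rightarrow> rat poly set \<times> rat poly set \<Rightarrow> rat poly set \<times> rat poly set" where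
  "K_adams l u =
     lin_ext K_classical (\<lambda>a. chi0 (int (l * a))) (fst u)
     \<oplus>\<^bsub>K_classical\<^esub> lin_ext K_classical
       (\<lambda>a. (\<zero>\<^bsub>K0\<^esub>, x1 [^]\<^bsub>K1\<^esub> (l * a) \<otimes>\<^bsub>K1\<^esub> (\<Oplus>\<^bsub>K1\<^esub>i\<in>{..<l}. x1 [^]\<^bsub>K1\<^esub> (- int i))))
       (snd u)"

section \<open>Virtual Chow ring\<close>

definition A0 :: "(rat, rat poly set) module" where
  "A0 = sector (2 * X ^ 2)"

definition A1 :: "(rat, rat poly set) module" where
  "A1 = sector (2 * X)"

definition y0 :: "rat poly set" where
  "y0 = sector_gen (2 * X ^ 2)"

definition y1 :: "rat poly set" where
  "y1 = sector_gen (2 * X)"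

definition A_classical :: "(rat, rat poly set \<times> rat poly set) module" where
  "A_classical = alg_sum A0 A1"

definition c0 :: "nat \<Rightarrow> rat poly set \<times> rat poly set" where
  "c0 a = (y0 [^]\<^bsub>A0\<^esub> a, \<zero>\<^bsub>A1\<^esub>)"

definition c1 :: "nat \<Rightarrow> rat poly set \<times> rat poly set" where
  "c1 a = (\<zero>\<^bsub>A0\<^esub>, y1 [^]\<^bsub>A1\<^esub> a)"

definition A_star ::
    "rat poly set \<times> rat poly set \<Rightarrow> rat poly set \<times> rat poly set \<Rightarrow> rat poly set \<times> rat poly set"
  where
  "A_star u v =
     bilin_ext A_classical (\<lambda>a b. c0 (a + b)) (fst u) (fst v)
     \<oplus>\<^bsub>A_classical\<^esub> bilin_ext A_classical (\<lambda>a b. c1 (a + b)) (fst u) (snd v)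
     \<oplus>\<^bsub>A_classical\<^esub> bilin_ext A_classical (\<lambda>a b. c1 (a + b)) (snd u) (fst v)
     \<oplus>\<^bsub>A_classical\<^esub> bilin_ext A_classical (\<lambda>a b. c0 (a + b + 2)) (snd u) (snd v)"

definition A_virt :: "(rat, rat poly set \<times> rat poly set) module" where
  "A_virt = A_classical\<lparr>monoid.mult := A_star, one := c0 0\<rparr>"

text \<open>Rationally, \<open>c0 0\<close>, \<open>c0 1\<close> and \<open>c1 0\<close> span everything, so there is nothing in degree 2 or more.\<close>

definition A_deg :: "nat \<Rightarrow> (rat poly set \<times> rat poly set) set" where
  "A_deg d =
     (if d = 0 then {r \<odot>\<^bsub>A_virt\<^esub> c0 0 | r. True}
      else if d = 1 then {r \<odot>\<^bsub>A_virt\<^esub> c0 1 \<oplus>\<^bsub>A_virt\<^esub> s \<odot>\<^bsub>A_virt\<^esub> c1 0 | r s. True}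
      else {\<zero>\<^bsub>A_virt\<^esub>})"

definition Ch :: "rat poly set \<times> rat poly set \<Rightarrow> rat poly set \<times> rat poly set" where
  "Ch u =
     lin_ext A_virt (\<lambda>a. c0 0 \<oplus>\<^bsub>A_virt\<^esub> of_nat a \<odot>\<^bsub>A_virt\<^esub> c0 1) (fst u)
     \<oplus>\<^bsub>A_virt\<^esub> lin_ext A_virt (\<lambda>a. c1 0) (snd u)"

definition ctilde1 :: "rat poly set \<times> rat poly set \<Rightarrow> rat poly set \<times> rat poly set" where
  "ctilde1 u = degree_part A_virt A_deg 1 (Ch u)"

section \<open>The two presentations\<close>

text \<open>Polynomials in two variables: the coefficient variable is \<open>V\<close>, the outer one is \<open>W\<close>.\<close>

definition Qxy :: "(rat, rat poly poly) module" where
  "Qxy = \<lparr>carrier = UNIV, monoid.mult = (*), one = 1, zero = 0, add = (+),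
          module.smult = (\<lambda>r. Polynomial.smult [:r:])\<rparr>"

abbreviation V :: "rat poly poly" where "V \<equiv> [:[:0, 1:]:]"
abbreviation W :: "rat poly poly" where "W \<equiv> [:0, 1:]"

definition I_K :: "rat poly poly set" where
  "I_K = Idl\<^bsub>Qxy\<^esub> {(W - 1) * (W ^ 2 - 1), (V - 1) * (V ^ 2 - 1), (V - W) * (W - 1)}"

definition P_K :: "(rat, rat poly poly set) module" where
  "P_K = quot_alg Qxy I_K"

definition \<sigma> :: "rat poly poly set" where "\<sigma> = I_K +>\<^bsub>Qxy\<^esub> V"
definition \<tau> :: "rat poly poly set" where "\<tau> = I_K +>\<^bsub>Qxy\<^esub> W"

definition subst_powers :: "nat \<Rightarrow> rat poly poly \<Rightarrow> rat poly poly" where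
  "subst_powers l p = pcompose (map_poly (\<lambda>q. pcompose q (monom 1 l)) p) (monom 1 l)"

text \<open>Induced by \<open>\<sigma> \<mapsto> \<sigma>\<^sup>l\<close>, \<open>\<tau> \<mapsto> \<tau>\<^sup>l\<close>.\<close>

definition P_adams :: "nat \<Rightarrow> rat poly poly set \<Rightarrow> rat poly poly set" where
  "P_adams l U = (\<Union>p\<in>U. I_K +>\<^bsub>Qxy\<^esub> subst_powers l p)"

definition I_A :: "rat poly poly set" where
  "I_A = ideal_prod Qxy (Idl\<^bsub>Qxy\<^esub> {V, W}) (Idl\<^bsub>Qxy\<^esub> {V, W})"

definition P_A :: "(rat, rat poly poly set) module" where
  "P_A = quot_alg Qxy I_A"

definition \<mu> :: "rat poly poly set" where "\<mu> = I_A +>\<^bsub>Qxy\<^esub> V"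
definition \<nu> :: "rat poly poly set" where "\<nu> = I_A +>\<^bsub>Qxy\<^esub> W"

text \<open>Classes of homogeneous polynomials, both variables having degree 1.\<close>

definition P_A_deg :: "nat \<Rightarrow> rat poly poly set set" where
  "P_A_deg d = {I_A +>\<^bsub>Qxy\<^esub> p | p. \<forall>i j. coeff (coeff p j) i \<noteq> 0 \<longrightarrow> i + j = d}"

text \<open>The image of \<open>\<tau>\<close>, for the sign \<open>\<epsilon> = \<plusminus>1\<close>.\<close>

definition tau_img :: "rat \<Rightarrow> rat poly set \<times> rat poly set" where
  "tau_img \<epsilon> =
     (1 / 2) \<odot>\<^bsub>K_virt\<^esub> (chi0 0 \<oplus>\<^bsub>K_virt\<^esub> chi0 1 \<oplus>\<^bsub>K_virt\<^esub> \<epsilon> \<odot>\<^bsub>K_virt\<^esub> chi1 0)"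

end

theory Submission
  imports Defs
begin

text \<open>
  The quotient of \<open>\<rat>[\<sigma>, \<tau>]\<close> and the virtual \<open>K\<close>-theory ring are the same product of three local algebras,
  seen in different coordinates.

  The relations of the presentation cut out the three points \<open>(\<sigma>, \<tau>) = (1, 1), (-1, 1), (-1, -1)\<close> of
  the plane, the first one with its full first order neighbourhood. A polynomial is therefore
  determined modulo \<open>I_K\<close> by its value and its two partial derivatives at \<open>(1, 1)\<close> and its values at the
  two other points (\<open>I_K_kernel\<close>), so that the quotient is \<open>\<rat>[e, f]/(e, f)\<^sup>2 \<times> \<rat> \<times> \<rat>\<close>.

  On the geometric side, write \<open>x = \<chi>\<^sub>0\<close> and let \<open>y\<close> be the unit of the twisted sector. Then
  \<open>x\<^sup>-\<^sup>1 = 1 + x - x\<^sup>2\<close>, so the star product is governed by \<open>y\<^sup>2 = (1 - x\<^sup>-\<^sup>1)\<^sup>2 = (x\<^sup>2 - x)\<^sup>2\<close>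
  (\<open>K_star_pair\<close>). This vanishes to second order at \<open>x = 1\<close>, where \<open>y\<close> is thus a second nilpotent tangent
  direction, and it equals \<open>4\<close> at \<open>x = -1\<close>, where the ring splits into the points \<open>y = 2\<close> and \<open>y = -2\<close>.
  This is the same product of local algebras (\<open>coordinates_K\<close>). The element \<open>(1 + x + \<epsilon> y) / 2\<close> takes the
  value \<open>1\<close> or \<open>-1\<close> at the point \<open>\<epsilon> y = 2\<close> or \<open>\<epsilon> y = -2\<close>, exactly like \<open>\<tau>\<close>. Choosing \<open>\<epsilon>\<close> amounts to
  choosing which of the two points is called \<open>\<tau> = 1\<close>, and this is where the two isomorphisms come from.

  Everything else is compared in these coordinates. The \<open>l\<close>-th Adams operation is on both sides the
  \<open>l\<close>-th power map of the points: it multiplies tangent coordinates at \<open>(1, 1)\<close> by \<open>l\<close>, and sends \<open>-1\<close> to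
  \<open>(-1)\<^sup>l\<close> (\<open>K_adams_coords\<close>, \<open>K_pres_coords_subst_powers\<close>). Both Chow-theoretic rings are
  \<open>\<rat>[e, f]/(e, f)\<^sup>2\<close>, graded by the order in \<open>e, f\<close>, and the inertial Chern character forgets the two isolated
  points and keeps the jet at \<open>(1, 1)\<close> (\<open>Ch_coords\<close>).
\<close>

section \<open>Quotients of commutative algebras over the rationals\<close>

definition type_alg :: "(rat \<Rightarrow> 'a \<Rightarrow> 'a) \<Rightarrow> (rat, 'a::comm_ring_1) module" where
  "type_alg s = \<lparr>carrier = UNIV, monoid.mult = (*), one = 1, zero = 0, add = (+), module.smult = s\<rparr>"

lemma type_alg_simps [simp]:
  "carrier (type_alg s) = UNIV" "x \<otimes>\<^bsub>type_alg s\<^esub> y = x * y" "\<one>\<^bsub>type_alg s\<^esub> = 1"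
  "x \<oplus>\<^bsub>type_alg s\<^esub> y = x + y" "\<zero>\<^bsub>type_alg s\<^esub> = 0" "r \<odot>\<^bsub>type_alg s\<^esub> x = s r x"
  by (simp_all add: type_alg_def)

lemma rat_field_simps [simp]:
  "carrier rat_field = UNIV" "x \<otimes>\<^bsub>rat_field\<^esub> y = x * y" "\<one>\<^bsub>rat_field\<^esub> = 1"
  "x \<oplus>\<^bsub>rat_field\<^esub> y = x + y" "\<zero>\<^bsub>rat_field\<^esub> = 0"
  by (simp_all add: rat_field_def)

lemma cring_rat_field: "cring rat_field"
proof (rule cringI)
  show "abelian_group rat_field"
    by (rule abelian_groupI) (auto simp: algebra_simps intro: exI[of _ "- _"])
  show "comm_monoid rat_field" by (rule comm_monoidI) auto
qed (auto simp: algebra_simps)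

lemma cring_type_alg: "cring (type_alg s)"
proof (rule cringI)
  show "abelian_group (type_alg s)"
    by (rule abelian_groupI) (auto simp: algebra_simps intro: exI[of _ "- _"])
  show "comm_monoid (type_alg s)" by (rule comm_monoidI) (auto simp: mult.assoc mult.commute)
qed (auto simp: algebra_simps)

lemma ring_type_alg: "ring (type_alg s)"
  using cring_type_alg cring.axioms(1) by blast

text \<open>
  The algebra axioms as one flat list of equations, with additive inverses realised by scaling with \<open>-1\<close>.
  Each equation can then be verified on representatives or in coordinates.
\<close>

lemma rat_algebraI:
  fixes A :: "(rat, 'a) module"
  assumes "\<And>x y. x \<in> carrier A \<Longrightarrow> y \<in> carrier A \<Longrightarrow> x \<oplus>\<^bsub>A\<^esub> y \<in> carrier A"
    and "\<And>x y. x \<in> carrier A \<Longrightarrow> y \<in> carrier A \<Longrightarrow> x \<otimes>\<^bsub>A\<^esub> y \<in> carrier A"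
    and "\<And>r x. x \<in> carrier A \<Longrightarrow> r \<odot>\<^bsub>A\<^esub> x \<in> carrier A"
    and "\<zero>\<^bsub>A\<^esub> \<in> carrier A" and "\<one>\<^bsub>A\<^esub> \<in> carrier A"
    and "\<And>x y z. x \<in> carrier A \<Longrightarrow> y \<in> carrier A \<Longrightarrow> z \<in> carrier A \<Longrightarrow>
          (x \<oplus>\<^bsub>A\<^esub> y) \<oplus>\<^bsub>A\<^esub> z = x \<oplus>\<^bsub>A\<^esub> (y \<oplus>\<^bsub>A\<^esub> z)"
    and "\<And>x y. x \<in> carrier A \<Longrightarrow> y \<in> carrier A \<Longrightarrow> x \<oplus>\<^bsub>A\<^esub> y = y \<oplus>\<^bsub>A\<^esub> x"
    and "\<And>x. x \<in> carrier A \<Longrightarrow> \<zero>\<^bsub>A\<^esub> \<oplus>\<^bsub>A\<^esub> x = x"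
    and "\<And>x. x \<in> carrier A \<Longrightarrow> (-1) \<odot>\<^bsub>A\<^esub> x \<oplus>\<^bsub>A\<^esub> x = \<zero>\<^bsub>A\<^esub>"
    and "\<And>x y z. x \<in> carrier A \<Longrightarrow> y \<in> carrier A \<Longrightarrow> z \<in> carrier A \<Longrightarrow>
          (x \<otimes>\<^bsub>A\<^esub> y) \<otimes>\<^bsub>A\<^esub> z = x \<otimes>\<^bsub>A\<^esub> (y \<otimes>\<^bsub>A\<^esub> z)"
    and "\<And>x y. x \<in> carrier A \<Longrightarrow> y \<in> carrier A \<Longrightarrow> x \<otimes>\<^bsub>A\<^esub> y = y \<otimes>\<^bsub>A\<^esub> x"
    and "\<And>x. x \<in> carrier A \<Longrightarrow> \<one>\<^bsub>A\<^esub> \<otimes>\<^bsub>A\<^esub> x = x"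
    and "\<And>x y z. x \<in> carrier A \<Longrightarrow> y \<in> carrier A \<Longrightarrow> z \<in> carrier A \<Longrightarrow>
          (x \<oplus>\<^bsub>A\<^esub> y) \<otimes>\<^bsub>A\<^esub> z = (x \<otimes>\<^bsub>A\<^esub> z) \<oplus>\<^bsub>A\<^esub> (y \<otimes>\<^bsub>A\<^esub> z)"
    and "\<And>r t x. x \<in> carrier A \<Longrightarrow> (r + t) \<odot>\<^bsub>A\<^esub> x = r \<odot>\<^bsub>A\<^esub> x \<oplus>\<^bsub>A\<^esub> t \<odot>\<^bsub>A\<^esub> x"
    and "\<And>r x y. x \<in> carrier A \<Longrightarrow> y \<in> carrier A \<Longrightarrow>
          r \<odot>\<^bsub>A\<^esub> (x \<oplus>\<^bsub>A\<^esub> y) = r \<odot>\<^bsub>A\<^esub> x \<oplus>\<^bsub>A\<^esub> r \<odot>\<^bsub>A\<^esub> y"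
    and "\<And>r t x. x \<in> carrier A \<Longrightarrow> (r * t) \<odot>\<^bsub>A\<^esub> x = r \<odot>\<^bsub>A\<^esub> (t \<odot>\<^bsub>A\<^esub> x)"
    and "\<And>x. x \<in> carrier A \<Longrightarrow> 1 \<odot>\<^bsub>A\<^esub> x = x"
    and "\<And>r x y. x \<in> carrier A \<Longrightarrow> y \<in> carrier A \<Longrightarrow>
          (r \<odot>\<^bsub>A\<^esub> x) \<otimes>\<^bsub>A\<^esub> y = r \<odot>\<^bsub>A\<^esub> (x \<otimes>\<^bsub>A\<^esub> y)"
  shows "algebra rat_field A"
proof (rule algebraI)
  show "cring A"
  proof (rule cringI)
    show "abelian_group A"
      using assms(1,3,4,6-9) by (intro abelian_groupI) blast+
    show "comm_monoid A"
      using assms(2,5,10-12) by (intro comm_monoidI) blast+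
    show "(x \<oplus>\<^bsub>A\<^esub> y) \<otimes>\<^bsub>A\<^esub> z = (x \<otimes>\<^bsub>A\<^esub> z) \<oplus>\<^bsub>A\<^esub> (y \<otimes>\<^bsub>A\<^esub> z)"
      if "x \<in> carrier A" "y \<in> carrier A" "z \<in> carrier A" for x y z
      using that by (rule assms(13))
  qed
qed (simp_all add: cring_rat_field assms(3,14-18))

text \<open>
  Both polynomial rings live on a type of class \<open>comm_ring_1\<close> and differ only in their scalar
  multiplication, so that \<open>s\<close> is the parameter.
\<close>

locale rat_algebra_type =
  fixes s :: "rat \<Rightarrow> 'a::comm_ring_1 \<Rightarrow> 'a"
  assumes s_add_left: "s (a + b) x = s a x + s b x"
    and s_add_right: "s a (x + y) = s a x + s a y"
    and s_mult: "s (a * b) x = s a (s b x)"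
    and s_one: "s 1 x = x"
    and s_assoc: "s a x * y = s a (x * y)"
begin

lemma s_eq: "s a x = s a 1 * x"
  by (simp add: s_assoc)

lemma s_diff: "s a (x - y) = s a x - s a y"
  by (metis add_diff_cancel_right' diff_add_cancel s_add_right)

lemma s_minus_one: "s (- 1) x = - x"
proof -
  have "s 0 x = 0" using s_add_left[of 0 0 x] by simp
  then show ?thesis using s_add_left[of "-1" 1 x] by (simp add: s_one eq_neg_iff_add_eq_0)
qed

end

locale ideal_quotient = rat_algebra_type s
  for s :: "rat \<Rightarrow> 'a::comm_ring_1 \<Rightarrow> 'a" +
  fixes I :: "'a set"
  assumes I_ideal: "ideal I (type_alg s)"
begin

abbreviation coset :: "'a \<Rightarrow> 'a set" where "coset p \<equiv> I +>\<^bsub>type_alg s\<^esub> p"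
abbreviation Q :: "(rat, 'a set) module" where "Q \<equiv> quot_alg (type_alg s) I"

lemma I_zero: "0 \<in> I" and I_add: "x \<in> I \<Longrightarrow> y \<in> I \<Longrightarrow> x + y \<in> I"
  and I_mult: "x \<in> I \<Longrightarrow> y * x \<in> I"
proof -
  interpret ideal I "type_alg s" by (rule I_ideal)
  show "0 \<in> I" using additive_subgroup.zero_closed[OF additive_subgroup_axioms] by simp
  show "x \<in> I \<Longrightarrow> y \<in> I \<Longrightarrow> x + y \<in> I" using additive_subgroup.a_closed[OF additive_subgroup_axioms] by simp
  show "x \<in> I \<Longrightarrow> y * x \<in> I" using I_l_closed by simp
qed

lemma I_minus: "x \<in> I \<Longrightarrow> - x \<in> I"
  using I_mult[of x "- 1"] by simp

lemma I_diff: "x \<in> I \<Longrightarrow> y \<in> I \<Longrightarrow> x - y \<in> I"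
  using I_add[of x "- y"] I_minus by simp

lemma coset_iff: "x \<in> coset p \<longleftrightarrow> x - p \<in> I"
  by (auto simp: a_r_coset_def' intro: bexI[of _ "x - p"])

lemma coset_eq_iff: "coset p = coset q \<longleftrightarrow> p - q \<in> I"
proof
  assume "coset p = coset q"
  moreover have "p \<in> coset p" by (simp add: coset_iff I_zero)
  ultimately show "p - q \<in> I" by (simp add: coset_iff)
next
  assume pq: "p - q \<in> I"
  have "x - p \<in> I \<longleftrightarrow> x - q \<in> I" for x
    using I_add[OF _ pq, of "x - p"] I_diff[OF _ pq, of "x - q"] by auto
  then show "coset p = coset q" by (auto simp: coset_iff)
qed

lemma carrier_Q: "carrier Q = range coset"
  by (auto simp: quot_alg_def ring.defs FactRing_def A_RCOSETS_defs a_r_coset_defs)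

lemma coset_mem [simp]: "coset p \<in> carrier Q"
  by (simp add: carrier_Q)

lemma zero_Q: "\<zero>\<^bsub>Q\<^esub> = coset 0"
proof -
  have "\<zero>\<^bsub>Q\<^esub> = I" by (simp add: quot_alg_def ring.defs FactRing_def)
  then show ?thesis by (auto simp: a_r_coset_def')
qed

lemma one_Q: "\<one>\<^bsub>Q\<^esub> = coset 1"
  by (simp add: quot_alg_def ring.defs FactRing_def)

lemma add_Q: "coset p \<oplus>\<^bsub>Q\<^esub> coset q = coset (p + q)"
proof -
  interpret ideal I "type_alg s" by (rule I_ideal)
  show ?thesis using a_rcos_sum[of p q] by (simp add: quot_alg_def ring.defs FactRing_def)
qed

lemma mult_Q: "coset p \<otimes>\<^bsub>Q\<^esub> coset q = coset (p * q)"
proof -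
  interpret ideal I "type_alg s" by (rule I_ideal)
  show ?thesis using rcoset_mult_add[of p q] by (simp add: quot_alg_def ring.defs FactRing_def)
qed

lemma smult_Q: "r \<odot>\<^bsub>Q\<^esub> coset p = coset (s r p)"
proof -
  have "coset (s r x) = coset (s r p)" if "x \<in> coset p" for x
    using that I_mult[of "x - p" "s r 1"] by (simp add: coset_iff coset_eq_iff s_diff flip: s_eq)
  moreover have "p \<in> coset p" by (simp add: coset_iff I_zero)
  ultimately have "(\<Union>x\<in>coset p. coset (s r x)) = coset (s r p)" by blast
  then show ?thesis by (simp add: quot_alg_def ring.defs module.defs)
qed

lemmas Q_simps = zero_Q one_Q add_Q mult_Q smult_Q

lemma algebra_Q: "algebra rat_field Q"
proof (rule rat_algebraI)
qed (auto simp: carrier_Q Q_simps s_add_left s_add_right s_mult s_one s_assoc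
      s_minus_one add.assoc mult.assoc distrib_right, simp_all add: add.commute mult.commute)

lemma pow_Q: "coset p [^]\<^bsub>Q\<^esub> (n::nat) = coset (p ^ n)"
  by (induction n) (simp_all add: Q_simps mult.commute)

lemma cring_Q: "cring Q"
  using algebra_Q algebra.axioms(2) by blast

lemma inverse_Q:
  assumes "p * q - 1 \<in> I"
  shows "coset p \<in> Units Q" and "inv\<^bsub>Q\<^esub> coset p = coset q"
proof -
  interpret cring Q by (rule cring_Q)
  have 1: "coset p \<otimes>\<^bsub>Q\<^esub> coset q = \<one>\<^bsub>Q\<^esub>" using assms by (simp add: Q_simps coset_eq_iff)
  show "coset p \<in> Units Q" using 1 unfolding Units_def
    using m_comm[of "coset p" "coset q"] by auto
  show "inv\<^bsub>Q\<^esub> coset p = coset q" using comm_inv_char[OF _ _ 1] by simp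
qed

end

section \<open>Transport of structure along coordinates\<close>

lemma alg_isoD:
  assumes "alg_iso A B h"
  shows "algebra rat_field A" "algebra rat_field B" "h \<in> ring_hom A B" "cring A" "cring B"
    "bij_betw h (carrier A) (carrier B)" "h \<in> ring_iso A B" "ring_hom_cring A B h"
    "\<And>r x. x \<in> carrier A \<Longrightarrow> h (r \<odot>\<^bsub>A\<^esub> x) = r \<odot>\<^bsub>B\<^esub> h x"
proof -
  show 1: "algebra rat_field A" "algebra rat_field B" "h \<in> ring_hom A B"
    "bij_betw h (carrier A) (carrier B)" "h \<in> ring_iso A B"
   "\<And>r x. x \<in> carrier A \<Longrightarrow> h (r \<odot>\<^bsub>A\<^esub> x) = r \<odot>\<^bsub>B\<^esub> h x"
    using assms by (auto simp: alg_iso_def alg_hom_def ring_iso_def)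
  show 2: "cring A" "cring B" using 1(1,2) algebra.axioms(2) by blast+
  show "ring_hom_cring A B h" using 1 2
    by (intro ring_hom_cringI) (auto simp: ring_hom_ring_def ring_hom_ring_axioms_def cring_def)
qed

lemma alg_iso_inv:
  assumes "alg_iso A B h"
  shows "alg_iso B A (inv_into (carrier A) h)"
proof -
  note D = alg_isoD[OF assms]
  let ?k = "inv_into (carrier A) h"
  have r: "?k \<in> ring_iso B A" using ring_iso_set_sym[OF _ D(7)] D(4) by (auto simp: cring_def)
  have inj: "inj_on h (carrier A)" and im: "h ` carrier A = carrier B"
    using D(6) by (auto simp: bij_betw_def)
  have "?k (r \<odot>\<^bsub>B\<^esub> y) = r \<odot>\<^bsub>A\<^esub> ?k y" if y: "y \<in> carrier B" for r y
  proof -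
    obtain x where x: "x \<in> carrier A" "y = h x" using y im by auto
    then have "r \<odot>\<^bsub>B\<^esub> y = h (r \<odot>\<^bsub>A\<^esub> x)" by (simp add: D(9))
    moreover have "r \<odot>\<^bsub>A\<^esub> x \<in> carrier A"
      using module.smult_closed[OF algebra.axioms(1)[OF D(1)]] x(1) by simp
    ultimately show ?thesis using x inj by simp
  qed
  then show ?thesis using r D(1,2) by (auto simp: alg_iso_def alg_hom_def ring_iso_def)
qed

lemma alg_hom_trans:
  assumes "h \<in> alg_hom A B" "k \<in> alg_hom B C"
  shows "k \<circ> h \<in> alg_hom A C"
  using assms ring_hom_trans[of h A B k C] by (auto simp: alg_hom_def ring_hom_def Pi_iff)

lemma alg_iso_trans:
  assumes "alg_iso A B h" "alg_iso B C k"
  shows "alg_iso A C (k \<circ> h)"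
  using assms alg_hom_trans[of h A B k C] bij_betw_trans[of h _ _ k]
  by (auto simp: alg_iso_def)

lemma psi_ring_iso_inv:
  assumes "psi_ring_iso R \<psi> S \<phi> h"
  shows "psi_ring_iso S \<phi> R \<psi> (inv_into (carrier R) h)"
proof -
  let ?k = "inv_into (carrier R) h"
  have R: "psi_ring R \<psi>" and S: "psi_ring S \<phi>" and h: "h \<in> ring_iso R S"
    and eq: "\<And>l x. l \<ge> 1 \<Longrightarrow> x \<in> carrier R \<Longrightarrow> h (\<psi> l x) = \<phi> l (h x)"
    using assms by (auto simp: psi_ring_iso_def)
  have k: "?k \<in> ring_iso S R"
    using ring_iso_set_sym[OF _ h] R by (auto simp: psi_ring_def cring_def)
  have inj: "inj_on h (carrier R)" and im: "h ` carrier R = carrier S"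
    using h by (auto simp: ring_iso_def bij_betw_def)
  have "?k (\<phi> l y) = \<psi> l (?k y)" if l: "l \<ge> 1" and y: "y \<in> carrier S" for l y
  proof -
    obtain x where x: "x \<in> carrier R" "y = h x" using y im by auto
    have "\<psi> l x \<in> carrier R" using R l x(1) by (auto simp: psi_ring_def ring_hom_def)
    then show ?thesis using x inj eq[OF l x(1)] by (metis inv_into_f_f)
  qed
  then show ?thesis using R S k by (auto simp: psi_ring_iso_def)
qed

lemma psi_ring_iso_trans:
  assumes "psi_ring_iso R \<psi> S \<phi> h" "psi_ring_iso S \<phi> U \<xi> k"
  shows "psi_ring_iso R \<psi> U \<xi> (k \<circ> h)"
proof -
  have "h \<in> carrier R \<rightarrow> carrier S" using assms(1) by (auto simp: psi_ring_iso_def ring_iso_def ring_hom_def)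
  then show ?thesis using assms ring_iso_set_trans[of h R S k U] unfolding psi_ring_iso_def
    by (auto simp: Pi_iff)
qed

lemma graded_alg_iso_inv:
  assumes "graded_alg_iso A G B H h"
  shows "graded_alg_iso B H A G (inv_into (carrier A) h)"
proof -
  have iso: "alg_iso A B h" and H: "\<And>d. h ` G d = H d" and G: "graded_algebra A G"
    using assms by (auto simp: graded_alg_iso_def)
  have "inj_on h (carrier A)" using alg_isoD(6)[OF iso] by (simp add: bij_betw_def)
  moreover have "G d \<subseteq> carrier A" for d
    using G by (auto simp: graded_algebra_def submodule_def dest!: subgroup.subset[THEN subsetD])
  ultimately have "inv_into (carrier A) h ` H d = G d" for d
    unfolding H[symmetric] by simp
  then show ?thesis using assms alg_iso_inv[OF iso] by (simp add: graded_alg_iso_def)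
qed

lemma graded_alg_iso_trans:
  assumes "graded_alg_iso A G B H h" "graded_alg_iso B H C F k"
  shows "graded_alg_iso A G C F (k \<circ> h)"
  using assms alg_iso_trans[of A B h C k] by (simp add: graded_alg_iso_def flip: image_image)

text \<open>
  Here \<open>A\<close> is merely a set with operations. It inherits the axioms from \<open>T\<close> along the bijection \<open>h\<close>;
  in this way the star products turn out to be associative, commutative and unital without any
  computation with triple products.
\<close>

locale coordinates =
  fixes A :: "(rat, 'a) module" and T :: "(rat, 'b) module" and h :: "'a \<Rightarrow> 'b"
  assumes T: "algebra rat_field T"
    and bij: "bij_betw h (carrier A) (carrier T)"
    and add: "\<And>x y. x \<in> carrier A \<Longrightarrow> y \<in> carrier A \<Longrightarrow>
      x \<oplus>\<^bsub>A\<^esub> y \<in> carrier A \<and> h (x \<oplus>\<^bsub>A\<^esub> y) = h x \<oplus>\<^bsub>T\<^esub> h y"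
    and mult: "\<And>x y. x \<in> carrier A \<Longrightarrow> y \<in> carrier A \<Longrightarrow>
      x \<otimes>\<^bsub>A\<^esub> y \<in> carrier A \<and> h (x \<otimes>\<^bsub>A\<^esub> y) = h x \<otimes>\<^bsub>T\<^esub> h y"
    and smult: "\<And>r x. x \<in> carrier A \<Longrightarrow> r \<odot>\<^bsub>A\<^esub> x \<in> carrier A \<and> h (r \<odot>\<^bsub>A\<^esub> x) = r \<odot>\<^bsub>T\<^esub> h x"
    and zero: "\<zero>\<^bsub>A\<^esub> \<in> carrier A \<and> h \<zero>\<^bsub>A\<^esub> = \<zero>\<^bsub>T\<^esub>"
    and one: "\<one>\<^bsub>A\<^esub> \<in> carrier A \<and> h \<one>\<^bsub>A\<^esub> = \<one>\<^bsub>T\<^esub>"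
begin

lemma mem: "x \<in> carrier A \<Longrightarrow> h x \<in> carrier T"
  using bij by (auto simp: bij_betw_def)

lemma eqI: "x \<in> carrier A \<Longrightarrow> y \<in> carrier A \<Longrightarrow> h x = h y \<Longrightarrow> x = y"
  using bij by (auto simp: bij_betw_def inj_on_def)

lemma algebra_A: "algebra rat_field A"
proof -
  interpret T: algebra rat_field T by (rule T)
  have neg: "(-1) \<odot>\<^bsub>T\<^esub> x \<oplus>\<^bsub>T\<^esub> x = \<zero>\<^bsub>T\<^esub>" if "x \<in> carrier T" for x
    using T.smult_l_distr[of "-1" 1 x] T.smult_l_null[of x] T.smult_one[of x] that by simp
  note D = T.smult_l_distr[simplified] T.smult_assoc1[simplified] T.smult_one[simplified]
  show ?thesis
    by (rule rat_algebraI; (rule eqI)?)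
      (simp_all add: add mult smult zero one mem neg D T.smult_r_distr T.smult_assoc2
        T.add.m_assoc T.m_assoc T.l_distr, simp_all add: mem T.add.m_comm T.m_comm)
qed

lemma iso: "alg_iso A T h"
  using T algebra_A bij by (auto simp: alg_iso_def alg_hom_def add mult smult one mem intro!: ring_hom_memI)

lemma psi_ring_iso:
  assumes "psi_ring T \<phi>"
    and "\<And>l x. l \<ge> 1 \<Longrightarrow> x \<in> carrier A \<Longrightarrow> \<psi> l x \<in> carrier A \<and> h (\<psi> l x) = \<phi> l (h x)"
  shows "psi_ring_iso A \<psi> T \<phi> h"
proof -
  have hom: "\<phi> l \<in> ring_hom T T" if "l \<ge> 1" for l using assms(1) that by (auto simp: psi_ring_def)
  have "psi_ring A \<psi>" unfolding psi_ring_def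
  proof (intro conjI allI impI ballI)
    show "cring A" using algebra_A algebra.axioms(2) by blast
  next
    fix l :: nat assume l: "l \<ge> 1"
    show "\<psi> l \<in> ring_hom A A"
      using hom[OF l]
      by (intro ring_hom_memI) (auto intro!: eqI simp: assms(2)[OF l] add mult one ring_hom_def mem)
  next
    fix x assume "x \<in> carrier A"
    then show "\<psi> 1 x = x" using assms(1) by (auto intro!: eqI simp: assms(2) psi_ring_def mem)
  next
    fix k l :: nat and x assume "k \<ge> 1" "l \<ge> 1" "x \<in> carrier A"
    then show "\<psi> k (\<psi> l x) = \<psi> (k * l) x"
      using assms(1) by (auto intro!: eqI simp: assms(2) psi_ring_def mem)
  qed
  then show ?thesis using assms alg_isoD(7)[OF iso] by (auto simp: psi_ring_iso_def)
qed

end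

lemma homogeneous_decomp_iso:
  assumes iso: "alg_iso A B h" and G: "\<And>d. G d \<subseteq> carrier A"
    and x: "homogeneous_decomp A G x f"
  shows "homogeneous_decomp B (\<lambda>d. h ` G d) (h x) (h \<circ> f)"
proof -
  interpret ring_hom_cring A B h by (rule alg_isoD[OF iso])
  have f: "f d \<in> carrier A" for d using x G by (auto simp: homogeneous_decomp_def)
  have "h (f d) = \<zero>\<^bsub>B\<^esub> \<longleftrightarrow> f d = \<zero>\<^bsub>A\<^esub>" for d
    using alg_isoD(6)[OF iso] f hom_zero R.zero_closed by (metis bij_betw_imp_inj_on inj_onD)
  then have *: "{d. (h \<circ> f) d \<noteq> \<zero>\<^bsub>B\<^esub>} = {d. f d \<noteq> \<zero>\<^bsub>A\<^esub>}" by auto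
  show ?thesis using x f unfolding homogeneous_decomp_def *
    by (auto simp: hom_finsum comp_def)
qed

text \<open>
  The nontrivial direction is the trivial one for the inverse isomorphism.
\<close>

lemma homogeneous_decomp_iso_iff:
  assumes iso: "alg_iso A B h" and G: "\<And>d. G d \<subseteq> carrier A" and x: "x \<in> carrier A"
    and f: "\<And>d. f d \<in> carrier A" and H: "\<And>d. h ` G d = H d"
  shows "homogeneous_decomp A G x f \<longleftrightarrow> homogeneous_decomp B H (h x) (h \<circ> f)"
proof
  show "homogeneous_decomp B H (h x) (h \<circ> f)" if "homogeneous_decomp A G x f"
    using homogeneous_decomp_iso[OF iso G that] by (simp add: H)
next
  let ?k = "inv_into (carrier A) h"
  assume 1: "homogeneous_decomp B H (h x) (h \<circ> f)"
  have b: "inj_on h (carrier A)" "h ` carrier A = carrier B"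
    using alg_isoD(6)[OF iso] by (auto simp: bij_betw_def)
  have HB: "H d \<subseteq> carrier B" for d using G H b by blast
  have "(\<lambda>d. ?k ` H d) = G" using b G by (auto simp flip: H)
  moreover have "?k \<circ> (h \<circ> f) = f" "?k (h x) = x" using b f x by (auto simp: comp_def)
  ultimately show "homogeneous_decomp A G x f"
    using homogeneous_decomp_iso[OF alg_iso_inv[OF iso] HB 1] by simp
qed

context coordinates
begin

text \<open>
  Homogeneous decompositions in \<open>A\<close> and in \<open>T\<close> correspond to each other, so existence and uniqueness carry
  over, and with them the value of the definite description behind \<open>degree_part\<close>.
\<close>

lemma graded_iso:
  assumes H: "graded_algebra T H" and GA: "\<And>d. G d \<subseteq> carrier A" and GH: "\<And>d. h ` G d = H d"
  shows "graded_alg_iso A G T H h"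
    and "x \<in> carrier A \<Longrightarrow> degree_part A G d x \<in> carrier A \<and> h (degree_part A G d x) = degree_part T H d (h x)"
proof -
  interpret A: algebra rat_field A by (rule algebra_A)
  have HT: "H d \<subseteq> carrier T" for d
    unfolding GH[of d, symmetric] using GA[of d] mem by auto
  have in_G: "x \<in> G d" if "x \<in> carrier A" "h x \<in> H d" for x d
    using that GH[of d] GA[of d] eqI by (metis imageE subsetD)
  have GD: "x \<in> carrier A \<and> h x \<in> H d" if "x \<in> G d" for x d
    using that GA[of d] GH[of d] by blast
  have ex1: "\<exists>!g. homogeneous_decomp T H y g" if "y \<in> carrier T" for y
    using H that by (auto simp: graded_algebra_def)
  have decomp: "homogeneous_decomp A G x f \<longleftrightarrow> (\<forall>d. f d \<in> carrier A) \<and> homogeneous_decomp T H (h x) (h \<circ> f)"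
    if "x \<in> carrier A" for x f
  proof (cases "\<forall>d. f d \<in> carrier A")
    case True
    then show ?thesis using homogeneous_decomp_iso_iff[of A T h G x f H] iso GA GH that by blast
  next
    case False
    then show ?thesis using GA by (auto simp: homogeneous_decomp_def)
  qed
  have main: "\<exists>f. homogeneous_decomp A G x f \<and> (\<forall>f'. homogeneous_decomp A G x f' \<longrightarrow> f' = f)
     \<and> h \<circ> f = (THE g. homogeneous_decomp T H (h x) g)" if x: "x \<in> carrier A" for x
  proof -
    obtain g where g: "homogeneous_decomp T H (h x) g"
      and u: "\<And>g'. homogeneous_decomp T H (h x) g' \<Longrightarrow> g' = g"
      using ex1[OF mem[OF x]] by blast
    define f where "f = inv_into (carrier A) h \<circ> g"
    have "g d \<in> carrier T" for d using g HT by (auto simp: homogeneous_decomp_def)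
    then have f: "f d \<in> carrier A" "h (f d) = g d" for d
      using bij unfolding f_def by (auto simp: bij_betw_def f_inv_into_f inv_into_into)
    then have hf: "h \<circ> f = g" by auto
    have "homogeneous_decomp A G x f" using decomp[OF x] f hf g by simp
    moreover have "f' = f" if "homogeneous_decomp A G x f'" for f'
      using that decomp[OF x] u hf f eqI by (metis comp_apply ext)
    moreover have "(THE g. homogeneous_decomp T H (h x) g) = g" using g u by blast
    ultimately show ?thesis using hf by blast
  qed
  have "graded_algebra A G" unfolding graded_algebra_def
  proof (intro conjI allI ballI)
    show "algebra rat_field A" by (rule algebra_A)
  next
    fix d
    have sub: "submodule (H d) rat_field T" using H by (auto simp: graded_algebra_def)
    interpret T: algebra rat_field T by (rule T)
    note E = T.submoduleE[OF sub]
    obtain y where "y \<in> H d" using E(2) by blast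
    then have z: "\<zero>\<^bsub>T\<^esub> \<in> H d" using E(4)[of 0 y] HT[of d] T.smult_l_null by auto
    have inv: "\<ominus>\<^bsub>A\<^esub> x = (- 1) \<odot>\<^bsub>A\<^esub> x" if "x \<in> carrier A" for x
      using A.smult_l_minus[of 1 x] that A.smult_one[of x] A.R.minus_equality[of "-1" 1] by simp
    show "submodule (G d) rat_field A"
    proof (rule A.submoduleI)
      show "G d \<subseteq> carrier A" by (rule GA)
      show "\<zero>\<^bsub>A\<^esub> \<in> G d" by (rule in_G) (use z zero in auto)
      show "r \<odot>\<^bsub>A\<^esub> a \<in> G d" if "r \<in> carrier rat_field" "a \<in> G d" for r a
        using GD[OF that(2)] E(4)[of r "h a"] by (intro in_G) (auto simp: smult)
      then show "\<ominus>\<^bsub>A\<^esub> a \<in> G d" if "a \<in> G d" for a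
        using that inv[of a] GA[of d] by auto
      show "a \<oplus>\<^bsub>A\<^esub> b \<in> G d" if "a \<in> G d" "b \<in> G d" for a b
        using GD[OF that(1)] GD[OF that(2)] E(5) by (intro in_G) (auto simp: add)
    qed
  next
    fix d e x y assume "x \<in> G d" "y \<in> G e"
    moreover have "\<And>u v. u \<in> H d \<Longrightarrow> v \<in> H e \<Longrightarrow> u \<otimes>\<^bsub>T\<^esub> v \<in> H (d + e)"
      using H by (auto simp: graded_algebra_def)
    ultimately show "x \<otimes>\<^bsub>A\<^esub> y \<in> G (d + e)"
      using GD[of x d] GD[of y e] by (intro in_G) (auto simp: mult)
  next
    fix x assume "x \<in> carrier A"
    then show "\<exists>!f. homogeneous_decomp A G x f" using main by blast
  qed
  then show "graded_alg_iso A G T H h" using iso H GH by (simp add: graded_alg_iso_def)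
  show "degree_part A G d x \<in> carrier A \<and> h (degree_part A G d x) = degree_part T H d (h x)"
    if x: "x \<in> carrier A"
  proof -
    obtain f where f: "homogeneous_decomp A G x f" "\<forall>f'. homogeneous_decomp A G x f' \<longrightarrow> f' = f"
     "h \<circ> f = (THE g. homogeneous_decomp T H (h x) g)" using main[OF x] by blast
    then have "(THE f. homogeneous_decomp A G x f) = f" by blast
    then show ?thesis using f(1,3) decomp[OF x] by (metis comp_apply degree_part_def)
  qed
qed

end

section \<open>Two algebras of jets and values\<close>

text \<open>
  First order jets at a point of the plane, that is \<open>\<rat>[e, f]/(e, f)\<^sup>2\<close>, with \<open>(a, b, c)\<close> standing for
  \<open>a + b e + c f\<close>.
\<close>

definition jet_alg :: "(rat, rat \<times> rat \<times> rat) module" where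
  "jet_alg =
     \<lparr>carrier = UNIV,
      monoid.mult = (\<lambda>(a, b, c) (a', b', c'). (a * a', a * b' + b * a', a * c' + c * a')),
      one = (1, 0, 0), zero = (0, 0, 0),
      add = (\<lambda>(a, b, c) (a', b', c'). (a + a', b + b', c + c')),
      module.smult = (\<lambda>r (a, b, c). (r * a, r * b, r * c))\<rparr>"

text \<open>
  A first order jet at one point of the plane, together with the values at two further points.
\<close>

definition jet_points_alg :: "(rat, rat \<times> rat \<times> rat \<times> rat \<times> rat) module" where
  "jet_points_alg =
     \<lparr>carrier = UNIV,
      monoid.mult = (\<lambda>(a, b, c, d, e) (a', b', c', d', e').
        (a * a', a * b' + b * a', a * c' + c * a', d * d', e * e')),
      one = (1, 0, 0, 1, 1), zero = (0, 0, 0, 0, 0),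
      add = (\<lambda>(a, b, c, d, e) (a', b', c', d', e'). (a + a', b + b', c + c', d + d', e + e')),
      module.smult = (\<lambda>r (a, b, c, d, e). (r * a, r * b, r * c, r * d, r * e))\<rparr>"

lemma jet_alg_simps [simp]:
  "carrier jet_alg = UNIV"
  "(a, b, c) \<otimes>\<^bsub>jet_alg\<^esub> (a', b', c') = (a * a', a * b' + b * a', a * c' + c * a')"
  "\<one>\<^bsub>jet_alg\<^esub> = (1, 0, 0)" "\<zero>\<^bsub>jet_alg\<^esub> = (0, 0, 0)"
  "(a, b, c) \<oplus>\<^bsub>jet_alg\<^esub> (a', b', c') = (a + a', b + b', c + c')"
  "r \<odot>\<^bsub>jet_alg\<^esub> (a, b, c) = (r * a, r * b, r * c)"
  by (simp_all add: jet_alg_def)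

lemma jet_points_alg_simps [simp]:
  "carrier jet_points_alg = UNIV"
  "(a, b, c, d, e) \<otimes>\<^bsub>jet_points_alg\<^esub> (a', b', c', d', e') =
     (a * a', a * b' + b * a', a * c' + c * a', d * d', e * e')"
  "\<one>\<^bsub>jet_points_alg\<^esub> = (1, 0, 0, 1, 1)" "\<zero>\<^bsub>jet_points_alg\<^esub> = (0, 0, 0, 0, 0)"
  "(a, b, c, d, e) \<oplus>\<^bsub>jet_points_alg\<^esub> (a', b', c', d', e') =
     (a + a', b + b', c + c', d + d', e + e')"
  "r \<odot>\<^bsub>jet_points_alg\<^esub> (a, b, c, d, e) = (r * a, r * b, r * c, r * d, r * e)"
  by (simp_all add: jet_points_alg_def)

lemma algebra_jet: "algebra rat_field jet_alg"
  by (rule rat_algebraI) (auto simp: algebra_simps)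

lemma algebra_jet_points: "algebra rat_field jet_points_alg"
  by (rule rat_algebraI) (auto simp: algebra_simps)

definition jet_of_points :: "rat \<times> rat \<times> rat \<times> rat \<times> rat \<Rightarrow> rat \<times> rat \<times> rat" where
  "jet_of_points = (\<lambda>(a, b, c, d, e). (a, b, c))"

lemma jet_of_points_hom: "jet_of_points \<in> alg_hom jet_points_alg jet_alg"
  by (auto simp: alg_hom_def ring_hom_def jet_of_points_def)

text \<open>
  The pullback along \<open>(v, w) \<mapsto> (v\<^sup>l, w\<^sup>l)\<close> for jets at \<open>(1, 1)\<close> and values at \<open>(-1, 1)\<close> and \<open>(-1, -1)\<close>: for
  even \<open>l\<close> all three points are sent to \<open>(1, 1)\<close>, for odd \<open>l\<close> they stay where they are.
\<close>

definition psi_points :: "nat \<Rightarrow> rat \<times> rat \<times> rat \<times> rat \<times> rat \<Rightarrow> rat \<times> rat \<times> rat \<times> rat \<times> rat" where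
  "psi_points l = (\<lambda>(a, b, c, d, e).
     (a, of_nat l * b, of_nat l * c, if even l then a else d, if even l then a else e))"

lemma psi_ring_points: "psi_ring jet_points_alg psi_points"
  unfolding psi_ring_def
proof (intro conjI allI impI ballI)
  show "cring jet_points_alg" using algebra_jet_points algebra.axioms(2) by blast
qed (auto simp: ring_hom_def psi_points_def algebra_simps)

definition jet_deg :: "nat \<Rightarrow> (rat \<times> rat \<times> rat) set" where
  "jet_deg d = (if d = 0 then {(a, 0, 0) | a. True} else if d = 1 then {(0, b, c) | b c. True}
     else {(0, 0, 0)})"

lemma homogeneous_decomp_jet:
  "homogeneous_decomp jet_alg jet_deg (a, b, c) f \<longleftrightarrow>
     f = (\<lambda>d. if d = 0 then (a, 0, 0) else if d = 1 then (0, b, c) else (0, 0, 0))"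
proof -
  interpret algebra rat_field jet_alg by (rule algebra_jet)
  have S: "finite {d. f d \<noteq> (0,0,0)} \<and> (\<Oplus>\<^bsub>jet_alg\<^esub>d\<in>{d. f d \<noteq> (0,0,0)}. f d) = f 0 \<oplus>\<^bsub>jet_alg\<^esub> f 1"
    if f: "\<And>d. f d \<in> jet_deg d" for f
  proof -
    have sub: "{d. f d \<noteq> (0,0,0)} \<subseteq> {0, 1}"
      using f by (force simp: jet_deg_def split: if_splits)
    have "(\<Oplus>\<^bsub>jet_alg\<^esub>d\<in>{d. f d \<noteq> (0,0,0)}. f d) = (\<Oplus>\<^bsub>jet_alg\<^esub>d\<in>{0,1}. f d)"
      by (rule M.add.finprod_mono_neutral_cong_left) (use sub in auto)
    also have "\<dots> = f 0 \<oplus>\<^bsub>jet_alg\<^esub> f 1" by (cases "f (Suc 0)") simp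
    finally show ?thesis using sub finite_subset by auto
  qed
  show ?thesis
  proof
    assume h: "homogeneous_decomp jet_alg jet_deg (a, b, c) f"
    then have f: "f d \<in> jet_deg d" for d by (auto simp: homogeneous_decomp_def)
    obtain p where "f 0 = (p, 0, 0)" using f[of 0] by (auto simp: jet_deg_def)
    moreover obtain q r where "f 1 = (0, q, r)" using f[of 1] by (auto simp: jet_deg_def)
    ultimately have "f 0 = (a, 0, 0)" "f 1 = (0, b, c)"
      using h S[of f] f by (auto simp: homogeneous_decomp_def)
    moreover have "f d = (0, 0, 0)" if "d \<noteq> 0" "d \<noteq> 1" for d
      using f[of d] that by (simp add: jet_deg_def)
    ultimately show "f = (\<lambda>d. if d = 0 then (a, 0, 0) else if d = 1 then (0, b, c) else (0, 0, 0))"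
      by auto
  next
    assume f: "f = (\<lambda>d. if d = 0 then (a, 0, 0) else if d = 1 then (0, b, c) else (0, 0, 0))"
    have d: "f d \<in> jet_deg d" for d by (auto simp: f jet_deg_def)
    then have "finite {d. f d \<noteq> \<zero>\<^bsub>jet_alg\<^esub>}"
      and 1: "(\<Oplus>\<^bsub>jet_alg\<^esub>d\<in>{d. f d \<noteq> \<zero>\<^bsub>jet_alg\<^esub>}. f d) = f 0 \<oplus>\<^bsub>jet_alg\<^esub> f 1"
      using S[of f] by auto
    moreover have "(a, b, c) = f 0 \<oplus>\<^bsub>jet_alg\<^esub> f 1" by (simp add: f)
    ultimately show "homogeneous_decomp jet_alg jet_deg (a, b, c) f"
      using d unfolding homogeneous_decomp_def by metis
  qed
qed

lemma degree_part_jet: "degree_part jet_alg jet_deg 1 (a, b, c) = (0, b, c)"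
  by (simp add: degree_part_def homogeneous_decomp_jet)

lemma graded_jet: "graded_algebra jet_alg jet_deg"
  unfolding graded_algebra_def
proof (intro conjI allI ballI)
  show "algebra rat_field jet_alg" by (rule algebra_jet)
next
  interpret algebra rat_field jet_alg by (rule algebra_jet)
  have neg: "\<ominus>\<^bsub>jet_alg\<^esub> (a, b, c) = (- a, - b, - c)" for a b c
    by (rule M.minus_equality) auto
  show "submodule (jet_deg d) rat_field jet_alg" for d
    by (rule submoduleI) (auto simp: jet_deg_def neg split: if_splits)
next
  fix d e x y assume "x \<in> jet_deg d" "y \<in> jet_deg e"
  then show "x \<otimes>\<^bsub>jet_alg\<^esub> y \<in> jet_deg (d + e)"
    by (auto simp: jet_deg_def split: if_splits)
next
  fix x :: "rat \<times> rat \<times> rat"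
  show "\<exists>!f. homogeneous_decomp jet_alg jet_deg x f"
    by (cases x) (simp add: homogeneous_decomp_jet)
qed

section \<open>Sectors and linear extension\<close>

lemma Qx_eq: "Qx = type_alg Polynomial.smult"
  by (simp add: Qx_def type_alg_def)

interpretation Qx: rat_algebra_type "Polynomial.smult :: rat \<Rightarrow> rat poly \<Rightarrow> rat poly"
  by unfold_locales (simp_all add: smult_add_left smult_add_right)

lemma Idl_Qx: "Idl\<^bsub>Qx\<^esub> {f} = {p. f dvd p}"
proof -
  interpret cring Qx unfolding Qx_eq by (rule cring_type_alg)
  have "Idl\<^bsub>Qx\<^esub> {f} = PIdl\<^bsub>Qx\<^esub> f" using cgenideal_eq_genideal[of f] by (simp add: Qx_eq)
  then show ?thesis by (auto simp: cgenideal_def Qx_eq dvd_def mult.commute)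
qed

lemma quotient_sector: "ideal_quotient Polynomial.smult (Idl\<^bsub>Qx\<^esub> {f})"
proof -
  interpret ring Qx unfolding Qx_eq by (rule ring_type_alg)
  show ?thesis
    using genideal_ideal[of "{f}"] Qx.rat_algebra_type_axioms
    by (intro ideal_quotient.intro ideal_quotient_axioms.intro) (simp_all add: Qx_eq)
qed

text \<open>
  Sectors are quotients of the coordinate ring of a line. The presentations, treated further below, are
  quotients of the coordinate ring of the plane, with \<open>plane_class\<close> in place of \<open>line_class\<close>.
\<close>

definition line_class :: "rat poly \<Rightarrow> rat poly \<Rightarrow> rat poly set" where
  "line_class f p = Idl\<^bsub>Qx\<^esub> {f} +>\<^bsub>Qx\<^esub> p"

lemma in_line_class: "x \<in> line_class f p \<longleftrightarrow> f dvd x - p"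
  and line_class_eq_iff: "line_class f p = line_class f q \<longleftrightarrow> f dvd p - q"
  using ideal_quotient.coset_iff[OF quotient_sector[of f], of x p]
    ideal_quotient.coset_eq_iff[OF quotient_sector[of f], of p q]
  by (simp_all add: line_class_def Qx_eq Idl_Qx[unfolded Qx_eq])

lemma sector_simps:
  "carrier (sector f) = range (line_class f)"
  "\<zero>\<^bsub>sector f\<^esub> = line_class f 0" "\<one>\<^bsub>sector f\<^esub> = line_class f 1"
  "line_class f p \<oplus>\<^bsub>sector f\<^esub> line_class f q = line_class f (p + q)"
  "line_class f p \<otimes>\<^bsub>sector f\<^esub> line_class f q = line_class f (p * q)"
  "r \<odot>\<^bsub>sector f\<^esub> line_class f p = line_class f (Polynomial.smult r p)"
  "line_class f p [^]\<^bsub>sector f\<^esub> (n::nat) = line_class f (p ^ n)"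
  using ideal_quotient.carrier_Q[OF quotient_sector[of f]]
    ideal_quotient.zero_Q[OF quotient_sector[of f]]
    ideal_quotient.one_Q[OF quotient_sector[of f]]
    ideal_quotient.add_Q[OF quotient_sector[of f], of p q]
    ideal_quotient.mult_Q[OF quotient_sector[of f], of p q]
    ideal_quotient.smult_Q[OF quotient_sector[of f], of r p]
    ideal_quotient.pow_Q[OF quotient_sector[of f], of p n]
  by (simp_all add: line_class_def sector_def Qx_eq)

lemma sector_algebra: "algebra rat_field (sector f)"
  using ideal_quotient.algebra_Q[OF quotient_sector[of f]] by (simp add: sector_def Qx_eq)

lemma sector_gen_eq: "sector_gen f = line_class f X"
  by (simp add: sector_gen_def line_class_def)

lemma sector_inverse:
  assumes "f dvd p * q - 1"
  shows "inv\<^bsub>sector f\<^esub> line_class f p = line_class f q"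
  using ideal_quotient.inverse_Q(2)[OF quotient_sector[of f], of p q] assms
  by (simp add: line_class_def sector_def Qx_eq Idl_Qx[unfolded Qx_eq])

lemma sector_minus: "line_class f p \<ominus>\<^bsub>sector f\<^esub> line_class f q = line_class f (p - q)"
proof -
  interpret algebra rat_field "sector f" by (rule sector_algebra)
  have "\<ominus>\<^bsub>sector f\<^esub> line_class f q = line_class f (- q)"
    by (rule M.minus_equality) (auto simp: sector_simps)
  then show ?thesis by (simp add: a_minus_def sector_simps)
qed

lemma sector_finsum:
  assumes "finite S"
  shows "(\<Oplus>\<^bsub>sector f\<^esub>i\<in>S. line_class f (p i)) = line_class f (sum p S)"
proof -
  interpret algebra rat_field "sector f" by (rule sector_algebra)
  show ?thesis using assms by (induction S) (auto simp: sector_simps Pi_iff)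
qed

definition sectors :: "rat poly \<Rightarrow> rat poly \<Rightarrow> (rat, rat poly set \<times> rat poly set) module" where
  "sectors f g = alg_sum (sector f) (sector g)"

definition pair :: "rat poly \<Rightarrow> rat poly \<Rightarrow> rat poly \<Rightarrow> rat poly \<Rightarrow> rat poly set \<times> rat poly set" where
  "pair f g p q = (line_class f p, line_class g q)"

lemma sectors_simps:
  "\<zero>\<^bsub>sectors f g\<^esub> = pair f g 0 0"
  "pair f g p q \<oplus>\<^bsub>sectors f g\<^esub> pair f g p' q' = pair f g (p + p') (q + q')"
  "r \<odot>\<^bsub>sectors f g\<^esub> pair f g p q = pair f g (Polynomial.smult r p) (Polynomial.smult r q)"
  by (simp_all add: sectors_def alg_sum_def pair_def sector_simps)

lemma carrier_sectors: "carrier (sectors f g) = {pair f g p q | p q. True}"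
  by (auto simp: sectors_def alg_sum_def pair_def sector_simps)

lemma pair_mem [simp]: "pair f g p q \<in> carrier (sectors f g)"
  by (auto simp: carrier_sectors)

lemma pair_eqI: "f dvd p - p' \<Longrightarrow> g dvd q - q' \<Longrightarrow> pair f g p q = pair f g p' q'"
  by (simp add: pair_def line_class_eq_iff)

lemma abelian_group_sectors: "abelian_group (sectors f g)"
proof (rule abelian_groupI)
  fix x assume "x \<in> carrier (sectors f g)"
  then obtain p q where "x = pair f g p q" by (auto simp: carrier_sectors)
  then show "\<exists>y\<in>carrier (sectors f g). y \<oplus>\<^bsub>sectors f g\<^esub> x = \<zero>\<^bsub>sectors f g\<^esub>"
    by (intro bexI[of _ "pair f g (- p) (- q)"]) (auto simp: sectors_simps)
next
  fix x y assume "x \<in> carrier (sectors f g)" "y \<in> carrier (sectors f g)"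
  then show "x \<oplus>\<^bsub>sectors f g\<^esub> y \<in> carrier (sectors f g)"
    unfolding carrier_sectors by (force simp: sectors_simps)
qed (auto simp: carrier_sectors sectors_simps algebra_simps)

text \<open>
  Every representative \<open>q\<close> is the sum of its monomials, so the sum in \<open>lin_ext\<close> is \<open>F q\<close>; hence a linear map
  \<open>F\<close> that extends \<open>g\<close> and kills the relation is the value of \<open>lin_ext\<close>. All the operations on the
  inertial rings are computed by exhibiting such an \<open>F\<close>.
\<close>

lemma lin_ext_eq:
  fixes N :: "(rat, 'b) module"
  assumes N: "abelian_group N"
    and mem: "\<And>p. F p \<in> carrier N"
    and add: "\<And>p q. F (p + q) = F p \<oplus>\<^bsub>N\<^esub> F q"
    and smult: "\<And>r p. F (Polynomial.smult r p) = r \<odot>\<^bsub>N\<^esub> F p"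
    and g: "\<And>a. F (monom 1 a) = g a"
    and wd: "\<And>p q. f dvd p - q \<Longrightarrow> F p = F q"
  shows "lin_ext N g (line_class f p) = F p"
proof -
  interpret abelian_group N by (rule N)
  have "F 0 \<oplus>\<^bsub>N\<^esub> F 0 = F 0" using add[of 0 0] by simp
  then have F0: "F 0 = \<zero>\<^bsub>N\<^esub>" using mem[of 0] by (metis add.l_cancel_one')
  have sum: "F (\<Sum>a\<in>S. u a) = (\<Oplus>\<^bsub>N\<^esub>a\<in>S. F (u a))" if "finite S" for S and u :: "nat \<Rightarrow> rat poly"
    using that by (induction S) (auto simp: F0 add mem)
  have "(\<Oplus>\<^bsub>N\<^esub>a\<in>{..degree q}. coeff q a \<odot>\<^bsub>N\<^esub> g a) = F q" for q
  proof -
    have "coeff q a \<odot>\<^bsub>N\<^esub> g a = F (monom (coeff q a) a)" for a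
      by (simp add: smult_monom flip: g smult)
    then show ?thesis by (simp flip: sum add: poly_as_sum_of_monoms)
  qed
  then have "lin_ext N g (line_class f p) = the_elem (F ` line_class f p)" by (simp add: lin_ext_def)
  also have "F ` line_class f p = {F p}" using wd by (auto simp: in_line_class intro!: image_eqI[of _ _ p])
  finally show ?thesis by simp
qed

lemma bilin_ext_eq:
  fixes N :: "(rat, 'b) module"
  assumes N: "abelian_group N"
    and mem: "\<And>p q. F p q \<in> carrier N"
    and add: "\<And>p p' q. F (p + p') q = F p q \<oplus>\<^bsub>N\<^esub> F p' q" "\<And>p q q'. F p (q + q') = F p q \<oplus>\<^bsub>N\<^esub> F p q'"
    and smult: "\<And>r p q. F (Polynomial.smult r p) q = r \<odot>\<^bsub>N\<^esub> F p q"
       "\<And>r p q. F p (Polynomial.smult r q) = r \<odot>\<^bsub>N\<^esub> F p q"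
    and g: "\<And>a b. F (monom 1 a) (monom 1 b) = g a b"
    and wd: "\<And>p p' q. f dvd p - p' \<Longrightarrow> F p q = F p' q" "\<And>p q q'. f' dvd q - q' \<Longrightarrow> F p q = F p q'"
  shows "bilin_ext N g (line_class f p) (line_class f' q) = F p q"
proof -
  have "lin_ext N (g a) (line_class f' q) = F (monom 1 a) q" for a
    using assms by (intro lin_ext_eq[where F = "F (monom 1 a)"]) auto
  then have "bilin_ext N g (line_class f p) (line_class f' q) = lin_ext N (\<lambda>a. F (monom 1 a) q) (line_class f p)"
    by (simp add: bilin_ext_def)
  also have "\<dots> = F p q" using assms by (intro lin_ext_eq[where F = "\<lambda>p. F p q"]) auto
  finally show ?thesis .
qed

lemma dvd_diff_mult:
  fixes f :: "rat poly"
  assumes "f dvd p - p'" "f' dvd f * c"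
  shows "f' dvd c * (p * q) - c * (p' * q)" "f' dvd c * (q * p) - c * (q * p')"
proof -
  obtain k where k: "p - p' = f * k" using assms(1) by (auto simp: dvd_def)
  have "c * (p * q) - c * (p' * q) = (f * c) * (k * q)"
    unfolding right_diff_distrib[symmetric] left_diff_distrib[symmetric] k by (simp add: mult_ac)
  then show "f' dvd c * (p * q) - c * (p' * q)" using assms(2) by simp
  then show "f' dvd c * (q * p) - c * (q * p')" by (simp add: mult.commute)
qed

text \<open>
  The two possible targets of a product of sectors: classes in the untwisted sector, where a factor \<open>c\<close> may
  occur, and classes in the twisted sector.
\<close>

lemma bilin_ext_fst:
  assumes g: "\<And>a b. g a b = pair f0 f1 (c * monom 1 (a + b)) 0"
    and f: "f0 dvd f * c" "f0 dvd f' * c"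
  shows "bilin_ext (sectors f0 f1) g (line_class f p) (line_class f' q) = pair f0 f1 (c * (p * q)) 0"
proof (rule bilin_ext_eq[where F = "\<lambda>p q. pair f0 f1 (c * (p * q)) 0"])
  show "pair f0 f1 (c * (p * q)) 0 = pair f0 f1 (c * (p' * q)) 0" if "f dvd p - p'" for p p' q
    using dvd_diff_mult[OF that f(1)] by (simp add: pair_eqI)
  show "pair f0 f1 (c * (p * q)) 0 = pair f0 f1 (c * (p * q')) 0" if "f' dvd q - q'" for p q q'
    using dvd_diff_mult[OF that f(2)] by (simp add: pair_eqI)
qed (auto simp: g abelian_group_sectors sectors_simps algebra_simps mult_monom)

lemma bilin_ext_snd:
  assumes g: "\<And>a b. g a b = pair f0 f1 0 (monom 1 (a + b))"
    and f: "f1 dvd f" "f1 dvd f'"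
  shows "bilin_ext (sectors f0 f1) g (line_class f p) (line_class f' q) = pair f0 f1 0 (p * q)"
proof (rule bilin_ext_eq[where F = "\<lambda>p q. pair f0 f1 0 (p * q)"])
  show "pair f0 f1 0 (p * q) = pair f0 f1 0 (p' * q)" if "f dvd p - p'" for p p' q
    using dvd_diff_mult[OF that, of f1 1] f by (simp add: pair_eqI)
  show "pair f0 f1 0 (p * q) = pair f0 f1 0 (p * q')" if "f' dvd q - q'" for p q q'
    using dvd_diff_mult[OF that, of f1 1] f by (simp add: pair_eqI)
qed (auto simp: g abelian_group_sectors sectors_simps algebra_simps mult_monom)

section \<open>The two star products\<close>

definition relK0 :: "rat poly" where "relK0 = (X - 1) * (X ^ 2 - 1)"
definition relK1 :: "rat poly" where "relK1 = X ^ 2 - 1"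
definition relA0 :: "rat poly" where "relA0 = 2 * X ^ 2"
definition relA1 :: "rat poly" where "relA1 = 2 * X"

text \<open>
  Membership in the ideal of a sector is a condition on values and derivatives at the roots of the
  relation. This is what makes the coordinates below well defined and injective.
\<close>

lemma dvd_simple_root:
  fixes f :: "rat poly"
  assumes "poly f c \<noteq> 0"
  shows "[:- c, 1:] * f dvd p \<longleftrightarrow> poly p c = 0 \<and> f dvd p"
proof
  assume "poly p c = 0 \<and> f dvd p"
  then obtain k where "p = f * k" by (auto elim!: dvdE)
  moreover from this have "poly k c = 0" using \<open>_ \<and> _\<close> assms by simp
  ultimately have "p = f * k" "poly k c = 0" by blast+
  then show "[:- c, 1:] * f dvd p"
    by (simp only: mult.commute[of _ f] mult_dvd_mono dvd_refl poly_eq_0_iff_dvd)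
next
  assume "[:- c, 1:] * f dvd p"
  then show "poly p c = 0 \<and> f dvd p"
    by (meson dvd_mult_left dvd_mult_right poly_eq_0_iff_dvd)
qed

lemma dvd_double_root:
  fixes p :: "rat poly"
  shows "[:- c, 1:] * [:- c, 1:] dvd p \<longleftrightarrow> poly p c = 0 \<and> poly (pderiv p) c = 0"
proof
  assume "poly p c = 0 \<and> poly (pderiv p) c = 0"
  then obtain k where p: "p = [:- c, 1:] * k" by (auto simp: poly_eq_0_iff_dvd elim!: dvdE)
  then have "poly (pderiv p) c = poly k c" by (simp only: p pderiv_mult) (simp add: pderiv_pCons)
  then have "[:- c, 1:] dvd k" using \<open>_ \<and> _\<close> by (simp add: poly_eq_0_iff_dvd)
  then show "[:- c, 1:] * [:- c, 1:] dvd p" by (simp only: p mult_dvd_mono dvd_refl)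
next
  assume "[:- c, 1:] * [:- c, 1:] dvd p"
  then obtain k where p: "p = [:- c, 1:] * ([:- c, 1:] * k)" by (auto elim!: dvdE simp only: mult.assoc)
  show "poly p c = 0 \<and> poly (pderiv p) c = 0" by (simp only: p pderiv_mult) simp
qed

lemma relK0_dvd: "relK0 dvd p \<longleftrightarrow> poly p 1 = 0 \<and> poly (pderiv p) 1 = 0 \<and> poly p (- 1) = 0"
proof -
  have "relK0 = [:- (- 1), 1:] * ([:- 1, 1:] * [:- 1, 1:])" by (simp add: relK0_def power2_eq_square one_pCons)
  then show ?thesis using dvd_simple_root[of "[:- 1, 1:] * [:- 1, 1:]" "- 1" p] dvd_double_root[of 1 p] by auto
qed

lemma relK1_dvd: "relK1 dvd p \<longleftrightarrow> poly p 1 = 0 \<and> poly p (- 1) = 0"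
proof -
  have "relK1 = [:- (- 1), 1:] * [:- 1, 1:]" by (simp add: relK1_def power2_eq_square one_pCons)
  then show ?thesis using dvd_simple_root[of "[:- 1, 1:]" "- 1" p] by (auto simp: poly_eq_0_iff_dvd)
qed

lemma two_mult_dvd_iff: "2 * f dvd p \<longleftrightarrow> f dvd (p :: rat poly)"
proof -
  have "2 * f = Polynomial.smult 2 f" by (simp add: numeral_poly)
  then show ?thesis using smult_dvd_iff[of 2 f p] by simp
qed

lemma relA0_dvd: "relA0 dvd p \<longleftrightarrow> poly p 0 = 0 \<and> poly (pderiv p) 0 = 0"
  unfolding relA0_def two_mult_dvd_iff power2_eq_square using dvd_double_root[of 0 p] by simp

lemma relA1_dvd: "relA1 dvd p \<longleftrightarrow> poly p 0 = 0"
  unfolding relA1_def two_mult_dvd_iff using poly_eq_0_iff_dvd[of p 0] by simp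

lemma relA1_dvd_relA0: "relA1 dvd relA0"
  unfolding relA0_def relA1_def power2_eq_square mult.assoc[symmetric] by (rule dvd_triv_left)

lemma K_rel: "K0 = sector relK0" "K1 = sector relK1" "x0 = line_class relK0 X" "x1 = line_class relK1 X"
  "K_classical = sectors relK0 relK1"
  by (simp_all add: K0_def K1_def x0_def x1_def relK0_def relK1_def sector_gen_eq K_classical_def sectors_def)

lemma A_rel: "A0 = sector relA0" "A1 = sector relA1" "y0 = line_class relA0 X" "y1 = line_class relA1 X"
  "A_classical = sectors relA0 relA1"
  by (simp_all add: A0_def A1_def y0_def y1_def relA0_def relA1_def sector_gen_eq A_classical_def sectors_def)

abbreviation "K_pair \<equiv> pair relK0 relK1"
abbreviation "A_pair \<equiv> pair relA0 relA1"

lemma monom_X: "monom 1 n = X ^ n"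
  by (simp add: monom_altdef)

lemma chi0_int: "chi0 (int a) = K_pair (monom 1 a) 0"
  by (simp add: chi0_def K_rel int_pow_int sector_simps pair_def monom_X)

lemma chi1_int: "chi1 (int a) = K_pair 0 (monom 1 a)"
  by (simp add: chi1_def K_rel int_pow_int sector_simps pair_def monom_X)

lemma c0_eq: "c0 a = A_pair (monom 1 a) 0"
  by (simp add: c0_def A_rel sector_simps pair_def monom_X)

lemma c1_eq: "c1 a = A_pair 0 (monom 1 a)"
  by (simp add: c1_def A_rel sector_simps pair_def monom_X)

text \<open>
  The relation reads \<open>x\<^sup>3 - x\<^sup>2 - x + 1 = 0\<close>, which gives \<open>x (1 + x - x\<^sup>2) = 1\<close>.
\<close>

lemma x0_inverse: "x0 [^]\<^bsub>K0\<^esub> (- 1 :: int) = line_class relK0 (1 + X - X ^ 2)"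
proof -
  have "inv\<^bsub>sector relK0\<^esub> line_class relK0 X = line_class relK0 (1 + X - X ^ 2)"
    by (rule sector_inverse) (simp add: relK0_dvd pderiv_mult pderiv_diff pderiv_add pderiv_pCons power2_eq_square)
  then show ?thesis by (simp add: int_pow_def2 K_rel sector_simps)
qed

text \<open>
  On the twisted sector \<open>x\<^sup>2 = 1\<close>, so \<open>x\<close> and all its powers are their own inverses.
\<close>

lemma x1_neg_power: "x1 [^]\<^bsub>K1\<^esub> (- int i) = line_class relK1 (X ^ i)"
proof (cases "i = 0")
  case True
  then show ?thesis by (simp add: K_rel sector_simps)
next
  case False
  have "inv\<^bsub>sector relK1\<^esub> line_class relK1 (X ^ i) = line_class relK1 (X ^ i)"
    by (rule sector_inverse) (simp add: relK1_dvd flip: power_mult_distrib)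
  then show ?thesis using False by (simp add: int_pow_def2 K_rel sector_simps)
qed

text \<open>
  A polynomial representing \<open>(1 - x\<^sup>-\<^sup>1)\<^sup>2\<close>, the star square of the unit of the twisted sector.
\<close>

definition twisted_square :: "rat poly" where "twisted_square = (X ^ 2 - X) ^ 2"

lemma twisted_square_values: "poly twisted_square 1 = 0" "poly (pderiv twisted_square) 1 = 0" "poly twisted_square (- 1) = 4"
  by (simp_all add: twisted_square_def power2_eq_square pderiv_mult pderiv_diff pderiv_pCons)

lemma K_star_pair:
  "K_star (K_pair p q) (K_pair p' q') = K_pair (p * p' + twisted_square * (q * q')) (p * q' + q * p')"
proof -
  have 1: "bilin_ext K_classical (\<lambda>a b. chi0 (int (a + b))) (line_class relK0 p) (line_class relK0 p') = K_pair (1 * (p * p')) 0"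
    unfolding K_rel(5) chi0_int by (rule bilin_ext_fst) auto
  have 2: "bilin_ext K_classical (\<lambda>a b. chi1 (int (a + b))) (line_class relK0 p) (line_class relK1 q') = K_pair 0 (p * q')"
    unfolding K_rel(5) chi1_int by (rule bilin_ext_snd) (auto simp: relK0_def relK1_def)
  have 3: "bilin_ext K_classical (\<lambda>a b. chi1 (int (a + b))) (line_class relK1 q) (line_class relK0 p') = K_pair 0 (q * p')"
    unfolding K_rel(5) chi1_int by (rule bilin_ext_snd) (auto simp: relK0_def relK1_def)
  have 4: "bilin_ext K_classical
       (\<lambda>a b. (x0 [^]\<^bsub>K0\<^esub> (a + b) \<otimes>\<^bsub>K0\<^esub> (\<one>\<^bsub>K0\<^esub> \<ominus>\<^bsub>K0\<^esub> x0 [^]\<^bsub>K0\<^esub> (- 1 :: int)) [^]\<^bsub>K0\<^esub> (2::nat), \<zero>\<^bsub>K1\<^esub>))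
       (line_class relK1 q) (line_class relK1 q') = K_pair (twisted_square * (q * q')) 0"
    unfolding K_rel(5)
  proof (rule bilin_ext_fst)
    have [simp]: "1 - (1 + X - X ^ 2) = X ^ 2 - X" by simp
    show "(x0 [^]\<^bsub>K0\<^esub> (a + b) \<otimes>\<^bsub>K0\<^esub> (\<one>\<^bsub>K0\<^esub> \<ominus>\<^bsub>K0\<^esub> x0 [^]\<^bsub>K0\<^esub> (- 1 :: int)) [^]\<^bsub>K0\<^esub> (2::nat), \<zero>\<^bsub>K1\<^esub>) =
        K_pair (twisted_square * monom 1 (a + b)) 0" for a b
      unfolding x0_inverse
      by (simp only: K_rel sector_simps sector_minus pair_def twisted_square_def monom_X mult.commute) simp
    show "relK0 dvd relK1 * twisted_square" "relK0 dvd relK1 * twisted_square"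
      by (simp_all only: relK0_dvd pderiv_mult poly_mult poly_add twisted_square_values) (simp_all add: relK1_def)
  qed
  show ?thesis unfolding K_star_def
    by (simp only: 1 2 3 4 pair_def[of _ _ p] pair_def[of _ _ p'] fst_conv snd_conv)
      (simp add: K_rel sectors_simps)
qed

text \<open>
  The product of two twisted classes is shifted by \<open>c\<^sub>0\<^sup>2\<close>, which is zero because \<open>2\<close> is invertible.
\<close>

lemma A_star_pair: "A_star (A_pair p q) (A_pair p' q') = A_pair (p * p') (p * q' + q * p')"
proof -
  have 1: "bilin_ext A_classical (\<lambda>a b. c0 (a + b)) (line_class relA0 p) (line_class relA0 p') = A_pair (1 * (p * p')) 0"
    unfolding A_rel(5) c0_eq by (rule bilin_ext_fst) auto
  have 2: "bilin_ext A_classical (\<lambda>a b. c1 (a + b)) (line_class relA0 p) (line_class relA1 q') = A_pair 0 (p * q')"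
    unfolding A_rel(5) c1_eq by (rule bilin_ext_snd) (auto simp: relA1_dvd_relA0)
  have 3: "bilin_ext A_classical (\<lambda>a b. c1 (a + b)) (line_class relA1 q) (line_class relA0 p') = A_pair 0 (q * p')"
    unfolding A_rel(5) c1_eq by (rule bilin_ext_snd) (auto simp: relA1_dvd_relA0)
  have 4: "bilin_ext A_classical (\<lambda>a b. c0 (a + b + 2)) (line_class relA1 q) (line_class relA1 q') = A_pair (X ^ 2 * (q * q')) 0"
    unfolding A_rel(5) c0_eq
    by (rule bilin_ext_fst)
      (simp only: monom_X power_add mult.commute, simp_all add: relA0_dvd pderiv_mult pderiv_pCons power2_eq_square)
  have 5: "A_pair (p * p' + X ^ 2 * (q * q')) (p * q' + q * p') = A_pair (p * p') (p * q' + q * p')"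
    by (rule pair_eqI) (simp_all add: relA0_dvd pderiv_mult pderiv_pCons power2_eq_square)
  show ?thesis unfolding A_star_def
    by (simp only: 1 2 3 4 pair_def[of _ _ p] pair_def[of _ _ p'] fst_conv snd_conv)
      (simp add: A_rel sectors_simps 5)
qed

lemma K_virt_fields:
  "carrier K_virt = carrier K_classical" "\<zero>\<^bsub>K_virt\<^esub> = \<zero>\<^bsub>K_classical\<^esub>"
  "\<one>\<^bsub>K_virt\<^esub> = chi0 0" "x \<oplus>\<^bsub>K_virt\<^esub> y = x \<oplus>\<^bsub>K_classical\<^esub> y" "x \<otimes>\<^bsub>K_virt\<^esub> y = K_star x y"
  "r \<odot>\<^bsub>K_virt\<^esub> x = r \<odot>\<^bsub>K_classical\<^esub> x"
  by (simp_all add: K_virt_def)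

lemma A_virt_fields:
  "carrier A_virt = carrier A_classical" "\<zero>\<^bsub>A_virt\<^esub> = \<zero>\<^bsub>A_classical\<^esub>"
  "\<one>\<^bsub>A_virt\<^esub> = c0 0" "x \<oplus>\<^bsub>A_virt\<^esub> y = x \<oplus>\<^bsub>A_classical\<^esub> y" "x \<otimes>\<^bsub>A_virt\<^esub> y = A_star x y"
  "r \<odot>\<^bsub>A_virt\<^esub> x = r \<odot>\<^bsub>A_classical\<^esub> x"
  by (simp_all add: A_virt_def)

lemma K_virt_simps:
  "carrier K_virt = {K_pair p q | p q. True}" "\<zero>\<^bsub>K_virt\<^esub> = K_pair 0 0" "\<one>\<^bsub>K_virt\<^esub> = K_pair 1 0"
  "K_pair p q \<oplus>\<^bsub>K_virt\<^esub> K_pair p' q' = K_pair (p + p') (q + q')"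
  "K_pair p q \<otimes>\<^bsub>K_virt\<^esub> K_pair p' q' = K_pair (p * p' + twisted_square * (q * q')) (p * q' + q * p')"
  "r \<odot>\<^bsub>K_virt\<^esub> K_pair p q = K_pair (Polynomial.smult r p) (Polynomial.smult r q)"
  using chi0_int[of 0]
  by (simp_all add: K_virt_fields K_rel(5) carrier_sectors sectors_simps K_star_pair)

lemma A_virt_simps:
  "carrier A_virt = {A_pair p q | p q. True}" "\<zero>\<^bsub>A_virt\<^esub> = A_pair 0 0" "\<one>\<^bsub>A_virt\<^esub> = A_pair 1 0"
  "A_pair p q \<oplus>\<^bsub>A_virt\<^esub> A_pair p' q' = A_pair (p + p') (q + q')"
  "A_pair p q \<otimes>\<^bsub>A_virt\<^esub> A_pair p' q' = A_pair (p * p') (p * q' + q * p')"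
  "r \<odot>\<^bsub>A_virt\<^esub> A_pair p q = A_pair (Polynomial.smult r p) (Polynomial.smult r q)"
  using c0_eq[of 0]
  by (simp_all add: A_virt_fields A_rel(5) carrier_sectors sectors_simps A_star_pair)

section \<open>Coordinates on the inertial rings\<close>

text \<open>
  In the notation of the introduction, the element with representatives \<open>p\<close> and \<open>q\<close> is \<open>p(x) + q(x) y\<close>.
  The last two entries are its values at \<open>x = -1\<close>, \<open>y = \<plusminus>2 \<epsilon>\<close>. At \<open>x = 1\<close> its differential
  is \<open>p'(1) dx + q(1) dy\<close>; it is written in the basis \<open>dx, dt\<close> for \<open>t = (1 + x + \<epsilon> y) / 2\<close>, where
  \<open>dy = \<epsilon> (2 dt - dx)\<close>.
\<close>

definition K_coords :: "rat \<Rightarrow> rat poly \<Rightarrow> rat poly \<Rightarrow> rat \<times> rat \<times> rat \<times> rat \<times> rat" where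
  "K_coords \<epsilon> p q =
     (poly p 1, poly (pderiv p) 1 - \<epsilon> * poly q 1, 2 * \<epsilon> * poly q 1,
      poly p (- 1) + 2 * \<epsilon> * poly q (- 1), poly p (- 1) - 2 * \<epsilon> * poly q (- 1))"

text \<open>
  The same change of basis as in \<open>K_coords\<close>, with \<open>c\<^sub>0\<close> and the unit of the twisted sector in the
  roles of \<open>dx\<close> and \<open>dy\<close>.
\<close>

definition A_coords :: "rat \<Rightarrow> rat poly \<Rightarrow> rat poly \<Rightarrow> rat \<times> rat \<times> rat" where
  "A_coords \<epsilon> p q = (poly p 0, poly (pderiv p) 0 - \<epsilon> * poly q 0, 2 * \<epsilon> * poly q 0)"

definition on_pair :: "(rat poly \<Rightarrow> rat poly \<Rightarrow> 'b) \<Rightarrow> rat poly set \<times> rat poly set \<Rightarrow> 'b" where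
  "on_pair c z = the_elem ((\<lambda>(p, q). c p q) ` (fst z \<times> snd z))"

lemma on_pair_eq:
  assumes "\<And>p' q'. f dvd p' - p \<Longrightarrow> g dvd q' - q \<Longrightarrow> c p' q' = c p q"
  shows "on_pair c (pair f g p q) = c p q"
proof -
  have "(p, q) \<in> line_class f p \<times> line_class g q" by (simp add: in_line_class)
  moreover have "(\<lambda>(p, q). c p q) z = c p q" if "z \<in> line_class f p \<times> line_class g q" for z
    using assms[of "fst z" "snd z"] that by (auto simp: in_line_class)
  ultimately have "(\<lambda>(p, q). c p q) ` (line_class f p \<times> line_class g q) = {c p q}" by blast
  then show ?thesis by (simp add: on_pair_def pair_def)
qed

lemma on_pair_K: "on_pair (K_coords \<epsilon>) (K_pair p q) = K_coords \<epsilon> p q"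
  by (rule on_pair_eq) (simp add: relK0_dvd relK1_dvd K_coords_def pderiv_diff)

lemma on_pair_A: "on_pair (A_coords \<epsilon>) (A_pair p q) = A_coords \<epsilon> p q"
  by (rule on_pair_eq) (simp add: relA0_dvd relA1_dvd A_coords_def pderiv_diff)

lemma bij_betw_on_pair:
  assumes "\<And>p q. on_pair c (pair f g p q) = c p q"
    and "\<And>p q p' q'. c p q = c p' q' \<Longrightarrow> f dvd p - p' \<and> g dvd q - q'"
    and "\<And>y. \<exists>p q. c p q = y"
  shows "bij_betw (on_pair c) {pair f g p q | p q. True} UNIV"
  unfolding bij_betw_def
proof
  show "inj_on (on_pair c) {pair f g p q | p q. True}"
  proof (rule inj_onI)
    fix x y assume xy: "x \<in> {pair f g p q | p q. True}" "y \<in> {pair f g p q | p q. True}"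
      and eq: "on_pair c x = on_pair c y"
    then obtain p q p' q' where "x = pair f g p q" "y = pair f g p' q'" by blast
    moreover from this have "f dvd p - p' \<and> g dvd q - q'"
      using eq unfolding calculation assms(1) by (intro assms(2))
    ultimately show "x = y" by (simp add: pair_eqI)
  qed
  show "on_pair c ` {pair f g p q | p q. True} = UNIV"
  proof (intro equalityI subsetI UNIV_I)
    fix y
    obtain p q where "c p q = y" using assms(3) by blast
    then have "y = on_pair c (pair f g p q)" by (simp add: assms(1))
    then show "y \<in> on_pair c ` {pair f g p q | p q. True}" by blast
  qed
qed

text \<open>
  Multiplicativity uses the first two values of \<open>twisted_square\<close> for the jet, where the product of twisted
  parts disappears, and the value \<open>4\<close> for the isolated points, where \<open>(p + 2 \<epsilon> q) (p' + 2 \<epsilon> q')\<close>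
  contains \<open>4 q q'\<close>.
\<close>

lemma coordinates_K:
  assumes \<epsilon>: "\<epsilon> \<in> {1, - 1}"
  shows "coordinates K_virt jet_points_alg (on_pair (K_coords \<epsilon>))"
proof (rule coordinates.intro)
  show "algebra rat_field jet_points_alg" by (rule algebra_jet_points)
  show "bij_betw (on_pair (K_coords \<epsilon>)) (carrier K_virt) (carrier jet_points_alg)"
    unfolding K_virt_simps jet_points_alg_simps
  proof (rule bij_betw_on_pair)
    show "on_pair (K_coords \<epsilon>) (K_pair p q) = K_coords \<epsilon> p q" for p q by (rule on_pair_K)
    show "relK0 dvd p - p' \<and> relK1 dvd q - q'" if "K_coords \<epsilon> p q = K_coords \<epsilon> p' q'" for p q p' q'
      using that \<epsilon> by (auto simp: relK0_dvd relK1_dvd K_coords_def pderiv_diff)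
    show "\<exists>p q. K_coords \<epsilon> p q = y" for y
    proof -
      obtain a b c d e where y: "y = (a, b, c, d, e)" by (cases y)
      \<comment> \<open>\<open>p\<close> is the Taylor form \<open>a + (b + c / 2) (x - 1) + k (x - 1)\<^sup>2\<close>, where \<open>k\<close> corrects the value
        at \<open>-1\<close>, and \<open>q\<close> interpolates linearly between its two values.\<close>
      define k where "k = ((d + e) / 2 - a + 2 * (b + c / 2)) / 4"
      define p where "p = [:a - (b + c / 2) + k, b + c / 2 - 2 * k, k:]"
      define q where "q = Polynomial.smult \<epsilon> [:c / 4 + (d - e) / 8, c / 4 - (d - e) / 8:]"
      have p: "poly p 1 = a" "poly (pderiv p) 1 = b + c / 2" "poly p (- 1) = (d + e) / 2"
        by (simp_all add: p_def pderiv_pCons k_def field_simps)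
      have q: "poly q 1 = \<epsilon> * (c / 2)" "poly q (- 1) = \<epsilon> * ((d - e) / 4)"
        by (simp_all add: q_def field_simps)
      have e: "\<epsilon> * (\<epsilon> * r) = r" "2 * \<epsilon> * (\<epsilon> * r) = 2 * r" for r using \<epsilon> by auto
      have "K_coords \<epsilon> p q = y"
        by (simp only: K_coords_def p q y e) (simp add: field_simps)
      then show ?thesis by blast
    qed
  qed
  have sq: "\<epsilon> * \<epsilon> = 1" "\<epsilon> * (\<epsilon> * r) = r" for r using \<epsilon> by auto
  fix x assume "x \<in> carrier K_virt"
  then obtain p q where x: "x = K_pair p q" by (auto simp: K_virt_simps)
  show "r \<odot>\<^bsub>K_virt\<^esub> x \<in> carrier K_virt \<and>
      on_pair (K_coords \<epsilon>) (r \<odot>\<^bsub>K_virt\<^esub> x) = r \<odot>\<^bsub>jet_points_alg\<^esub> on_pair (K_coords \<epsilon>) x" for r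
    by (auto simp: x K_virt_simps on_pair_K) (simp add: K_coords_def algebra_simps pderiv_smult)
  fix y assume "y \<in> carrier K_virt"
  then obtain p' q' where y: "y = K_pair p' q'" by (auto simp: K_virt_simps)
  show "x \<oplus>\<^bsub>K_virt\<^esub> y \<in> carrier K_virt \<and>
      on_pair (K_coords \<epsilon>) (x \<oplus>\<^bsub>K_virt\<^esub> y) = on_pair (K_coords \<epsilon>) x \<oplus>\<^bsub>jet_points_alg\<^esub> on_pair (K_coords \<epsilon>) y"
    by (auto simp: x y K_virt_simps on_pair_K) (simp add: K_coords_def algebra_simps pderiv_add)
  show "x \<otimes>\<^bsub>K_virt\<^esub> y \<in> carrier K_virt \<and>
      on_pair (K_coords \<epsilon>) (x \<otimes>\<^bsub>K_virt\<^esub> y) = on_pair (K_coords \<epsilon>) x \<otimes>\<^bsub>jet_points_alg\<^esub> on_pair (K_coords \<epsilon>) y"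
    by (auto simp: x y K_virt_simps on_pair_K)
      (simp add: K_coords_def algebra_simps pderiv_add pderiv_mult twisted_square_values sq)
next
  show "\<zero>\<^bsub>K_virt\<^esub> \<in> carrier K_virt \<and> on_pair (K_coords \<epsilon>) \<zero>\<^bsub>K_virt\<^esub> = \<zero>\<^bsub>jet_points_alg\<^esub>"
    by (auto simp: K_virt_simps on_pair_K) (simp add: K_coords_def)
  show "\<one>\<^bsub>K_virt\<^esub> \<in> carrier K_virt \<and> on_pair (K_coords \<epsilon>) \<one>\<^bsub>K_virt\<^esub> = \<one>\<^bsub>jet_points_alg\<^esub>"
    by (auto simp: K_virt_simps on_pair_K) (simp add: K_coords_def)
qed

lemma coordinates_A:
  assumes \<epsilon>: "\<epsilon> \<in> {1, - 1}"
  shows "coordinates A_virt jet_alg (on_pair (A_coords \<epsilon>))"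
proof (rule coordinates.intro)
  show "algebra rat_field jet_alg" by (rule algebra_jet)
  show "bij_betw (on_pair (A_coords \<epsilon>)) (carrier A_virt) (carrier jet_alg)"
    unfolding A_virt_simps jet_alg_simps
  proof (rule bij_betw_on_pair)
    show "on_pair (A_coords \<epsilon>) (A_pair p q) = A_coords \<epsilon> p q" for p q by (rule on_pair_A)
    show "relA0 dvd p - p' \<and> relA1 dvd q - q'" if "A_coords \<epsilon> p q = A_coords \<epsilon> p' q'" for p q p' q'
      using that \<epsilon> by (auto simp: relA0_dvd relA1_dvd A_coords_def pderiv_diff)
    show "\<exists>p q. A_coords \<epsilon> p q = y" for y
    proof -
      obtain a b c where y: "y = (a, b, c)" by (cases y)
      have "A_coords \<epsilon> [:a, b + c / 2:] [:\<epsilon> * c / 2:] = y"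
        using \<epsilon> by (auto simp add: A_coords_def y pderiv_pCons)
      then show ?thesis by blast
    qed
  qed
  fix x assume "x \<in> carrier A_virt"
  then obtain p q where x: "x = A_pair p q" by (auto simp: A_virt_simps)
  show "r \<odot>\<^bsub>A_virt\<^esub> x \<in> carrier A_virt \<and>
      on_pair (A_coords \<epsilon>) (r \<odot>\<^bsub>A_virt\<^esub> x) = r \<odot>\<^bsub>jet_alg\<^esub> on_pair (A_coords \<epsilon>) x" for r
    by (auto simp: x A_virt_simps on_pair_A) (simp add: A_coords_def algebra_simps pderiv_smult)
  fix y assume "y \<in> carrier A_virt"
  then obtain p' q' where y: "y = A_pair p' q'" by (auto simp: A_virt_simps)
  show "x \<oplus>\<^bsub>A_virt\<^esub> y \<in> carrier A_virt \<and>
      on_pair (A_coords \<epsilon>) (x \<oplus>\<^bsub>A_virt\<^esub> y) = on_pair (A_coords \<epsilon>) x \<oplus>\<^bsub>jet_alg\<^esub> on_pair (A_coords \<epsilon>) y"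
    by (auto simp: x y A_virt_simps on_pair_A) (simp add: A_coords_def algebra_simps pderiv_add)
  show "x \<otimes>\<^bsub>A_virt\<^esub> y \<in> carrier A_virt \<and>
      on_pair (A_coords \<epsilon>) (x \<otimes>\<^bsub>A_virt\<^esub> y) = on_pair (A_coords \<epsilon>) x \<otimes>\<^bsub>jet_alg\<^esub> on_pair (A_coords \<epsilon>) y"
    by (auto simp: x y A_virt_simps on_pair_A) (simp add: A_coords_def algebra_simps pderiv_mult)
next
  show "\<zero>\<^bsub>A_virt\<^esub> \<in> carrier A_virt \<and> on_pair (A_coords \<epsilon>) \<zero>\<^bsub>A_virt\<^esub> = \<zero>\<^bsub>jet_alg\<^esub>"
    by (auto simp: A_virt_simps on_pair_A) (simp add: A_coords_def)
  show "\<one>\<^bsub>A_virt\<^esub> \<in> carrier A_virt \<and> on_pair (A_coords \<epsilon>) \<one>\<^bsub>A_virt\<^esub> = \<one>\<^bsub>jet_alg\<^esub>"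
    by (auto simp: A_virt_simps on_pair_A) (simp add: A_coords_def)
qed

lemma lin_ext_sectors:
  assumes add: "\<And>p q. F (p + q) = F p + F q" "\<And>p q. G (p + q) = G p + G q"
    and smult: "\<And>r p. F (Polynomial.smult r p) = Polynomial.smult r (F p)"
      "\<And>r p. G (Polynomial.smult r p) = Polynomial.smult r (G p)"
    and u: "\<And>a. u a = pair f g (F (monom 1 a)) (G (monom 1 a))"
    and dvd: "\<And>p q. h dvd p - q \<Longrightarrow> f dvd F p - F q" "\<And>p q. h dvd p - q \<Longrightarrow> g dvd G p - G q"
  shows "lin_ext (sectors f g) u (line_class h p) = pair f g (F p) (G p)"
proof (rule lin_ext_eq[where F = "\<lambda>p. pair f g (F p) (G p)"])
  show "pair f g (F p) (G p) = pair f g (F q) (G q)" if "h dvd p - q" for p q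
    using dvd[OF that] by (rule pair_eqI)
qed (simp_all add: add smult u abelian_group_sectors sectors_simps)

text \<open>
  On the twisted sector the Bott class \<open>\<Sum>i<l. x\<^sup>-\<^sup>i\<close> has the same class as \<open>\<Sum>i<l. x\<^sup>i\<close>.
\<close>

lemma K_adams_pair:
  "K_adams l (K_pair p q) = K_pair (pcompose p (X ^ l)) (pcompose q (X ^ l) * (\<Sum>i<l. X ^ i))"
proof -
  have pm: "pcompose (monom 1 a) (X ^ l) = X ^ (l * a)" for a
    by (induction a) (simp_all add: monom_Suc pcompose_pCons power_add pcompose_1)
  have pd: "poly (pderiv (pcompose u (X ^ l))) 1 = poly (pderiv u) 1 * of_nat l" for u :: "rat poly"
    by (simp add: pderiv_pcompose poly_pcompose pderiv_power pderiv_pCons)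
  have e: "poly u ((- 1) ^ l) = poly v ((- 1) ^ l)"
    if "poly u 1 = poly v 1" "poly u (- 1) = poly v (- 1)" for u v :: "rat poly"
    using that by (cases "even l") auto
  have 1: "lin_ext K_classical (\<lambda>a. chi0 (int (l * a))) (line_class relK0 p) = K_pair (pcompose p (X ^ l)) 0"
    unfolding K_rel(5)
  proof (rule lin_ext_sectors[where F = "\<lambda>p. pcompose p (X ^ l)" and G = "\<lambda>_. 0"])
    show "chi0 (int (l * a)) = K_pair (pcompose (monom 1 a) (X ^ l)) 0" for a
      by (simp only: chi0_int pm) (simp only: monom_X)
    show "relK0 dvd pcompose p (X ^ l) - pcompose q (X ^ l)" if "relK0 dvd p - q" for p q
      using that unfolding pcompose_diff[symmetric] relK0_dvd pd by (simp add: poly_pcompose e[of p q])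
  qed (auto simp: pcompose_add pcompose_smult)
  have 2: "lin_ext K_classical
       (\<lambda>a. (\<zero>\<^bsub>K0\<^esub>, x1 [^]\<^bsub>K1\<^esub> (l * a) \<otimes>\<^bsub>K1\<^esub> (\<Oplus>\<^bsub>K1\<^esub>i\<in>{..<l}. x1 [^]\<^bsub>K1\<^esub> (- int i)))) (line_class relK1 q)
     = K_pair 0 (pcompose q (X ^ l) * (\<Sum>i<l. X ^ i))"
    unfolding K_rel(5)
  proof (rule lin_ext_sectors[where F = "\<lambda>_. 0" and G = "\<lambda>q. pcompose q (X ^ l) * (\<Sum>i<l. X ^ i)"])
    show "(\<zero>\<^bsub>K0\<^esub>, x1 [^]\<^bsub>K1\<^esub> (l * a) \<otimes>\<^bsub>K1\<^esub> (\<Oplus>\<^bsub>K1\<^esub>i\<in>{..<l}. x1 [^]\<^bsub>K1\<^esub> (- int i))) =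
       K_pair 0 (pcompose (monom 1 a) (X ^ l) * (\<Sum>i<l. X ^ i))" for a
      unfolding x1_neg_power by (simp only: pm K_rel sector_simps sector_finsum finite_lessThan pair_def)
    show "relK1 dvd pcompose p (X ^ l) * (\<Sum>i<l. X ^ i) - pcompose q (X ^ l) * (\<Sum>i<l. X ^ i)"
      if "relK1 dvd p - q" for p q
      using that unfolding pcompose_diff[symmetric] left_diff_distrib[symmetric] relK1_dvd
      by (simp add: poly_pcompose e[of p q])
  qed (auto simp: pcompose_add pcompose_smult algebra_simps)
  show ?thesis unfolding K_adams_def
    by (simp only: 1 2 pair_def[of _ _ p] fst_conv snd_conv) (simp add: K_rel sectors_simps)
qed

text \<open>
  The Bott class takes the value \<open>l\<close> at \<open>x = 1\<close>, which is the factor by which tangent vectors are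
  scaled. At \<open>x = -1\<close> it is \<open>0\<close> for even \<open>l\<close> and \<open>1\<close> for odd \<open>l\<close>: in the even case the difference of the
  values at \<open>y = \<plusminus>2\<close> is killed, as it must be if both points are sent to \<open>(1, 1)\<close>.
\<close>

lemma K_adams_coords:
  assumes "x \<in> carrier K_virt"
  shows "K_adams l x \<in> carrier K_virt"
    "on_pair (K_coords \<epsilon>) (K_adams l x) = psi_points l (on_pair (K_coords \<epsilon>) x)"
proof -
  obtain p q where x: "x = K_pair p q" using assms by (auto simp: K_virt_simps)
  show "K_adams l x \<in> carrier K_virt" by (auto simp: x K_adams_pair K_virt_simps)
  have s: "(\<Sum>i<l. (- 1) ^ i) = (if even l then 0 else (1 :: rat))" by (induction l) auto
  show "on_pair (K_coords \<epsilon>) (K_adams l x) = psi_points l (on_pair (K_coords \<epsilon>) x)"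
    by (simp add: x K_adams_pair on_pair_K)
      (auto simp add: K_coords_def psi_points_def poly_pcompose pderiv_pcompose pderiv_power pderiv_pCons
        poly_sum s algebra_simps)
qed

lemma c_low: "c0 0 = A_pair 1 0" "c0 (Suc 0) = A_pair X 0" "c1 0 = A_pair 0 1"
  by (simp_all add: c0_eq c1_eq monom_X)

lemma Ch_pair: "Ch (K_pair p q) = A_pair [:poly p 1, poly (pderiv p) 1:] [:poly q 1:]"
proof -
  have lin: "lin_ext A_virt = lin_ext A_classical"
  proof -
    \<comment> \<open>The two algebras differ only in the product and its unit, which finite sums do not see.\<close>
    have "finsum A_virt = (finsum A_classical :: (nat \<Rightarrow> _) \<Rightarrow> _)"
      by (simp add: fun_eq_iff finsum_def A_virt_def)
    then show ?thesis unfolding fun_eq_iff lin_ext_def by (simp only: A_virt_fields) simp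
  qed
  have 1: "lin_ext A_virt (\<lambda>a. c0 0 \<oplus>\<^bsub>A_virt\<^esub> of_nat a \<odot>\<^bsub>A_virt\<^esub> c0 1) (line_class relK0 p) =
      A_pair [:poly p 1, poly (pderiv p) 1:] 0"
    unfolding lin A_rel(5)
    by (rule lin_ext_sectors[where F = "\<lambda>p. [:poly p 1, poly (pderiv p) 1:]" and G = "\<lambda>_. 0"])
      (auto simp: pderiv_add pderiv_smult c_low A_virt_simps pderiv_monom poly_monom relK0_dvd
        pderiv_diff one_pCons)
  have 2: "lin_ext A_virt (\<lambda>a. c1 0) (line_class relK1 q) = A_pair 0 [:poly q 1:]"
    unfolding lin A_rel(5)
    by (rule lin_ext_sectors[where F = "\<lambda>_. 0" and G = "\<lambda>q. [:poly q 1:]"])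
      (auto simp: c_low poly_monom relK1_dvd one_pCons)
  show ?thesis unfolding Ch_def
    by (simp only: 1 2 pair_def[of _ _ p] fst_conv snd_conv) (simp add: A_virt_simps)
qed

lemma Ch_coords:
  assumes "x \<in> carrier K_virt"
  shows "Ch x \<in> carrier A_virt"
    "on_pair (A_coords \<epsilon>) (Ch x) = jet_of_points (on_pair (K_coords \<epsilon>) x)"
proof -
  obtain p q where x: "x = K_pair p q" using assms by (auto simp: K_virt_simps)
  show "Ch x \<in> carrier A_virt" by (auto simp: x Ch_pair A_virt_simps)
  show "on_pair (A_coords \<epsilon>) (Ch x) = jet_of_points (on_pair (K_coords \<epsilon>) x)"
    by (simp add: x Ch_pair on_pair_A on_pair_K)
      (simp add: K_coords_def A_coords_def jet_of_points_def pderiv_pCons)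
qed

lemma A_deg_coords:
  assumes \<epsilon>: "\<epsilon> \<in> {1, - 1}"
  shows "A_deg d \<subseteq> carrier A_virt" "on_pair (A_coords \<epsilon>) ` A_deg d = jet_deg d"
proof -
  have 0: "A_deg 0 = {A_pair [:r:] 0 | r. True}"
    by (auto simp: A_deg_def c_low A_virt_simps one_pCons)
  have 1: "A_deg 1 = {A_pair [:0, r:] [:s:] | r s. True}"
    by (auto simp: A_deg_def c_low A_virt_simps one_pCons)
  have 2: "A_deg d = {A_pair 0 0}" if "d \<noteq> 0" "d \<noteq> 1" for d
    using that by (simp add: A_deg_def A_virt_simps)
  consider "d = 0" | "d = 1" | "d \<noteq> 0" "d \<noteq> 1" by blast
  note cs = this
  show "A_deg d \<subseteq> carrier A_virt"
    by (cases rule: cs) (auto simp: 0 1[unfolded One_nat_def] 2 A_virt_simps)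
  have "\<exists>r s. (0, b, c) = (0 :: rat, r - \<epsilon> * s, 2 * \<epsilon> * s)" for b c
    using \<epsilon> by (intro exI[of _ "b + c / 2"] exI[of _ "\<epsilon> * c / 2"]) auto
  moreover have v: "on_pair (A_coords \<epsilon>) (A_pair [:0, r:] [:s:]) = (0, r - \<epsilon> * s, 2 * \<epsilon> * s)" for r s
    by (simp add: on_pair_A A_coords_def pderiv_pCons)
  ultimately have "\<exists>r s. (0, b, c) = on_pair (A_coords \<epsilon>) (A_pair [:0, r:] [:s:])" for b c
    by simp
  then have j1: "on_pair (A_coords \<epsilon>) ` A_deg 1 = {(0, b, c) | b c. True}"
    unfolding 1 using v by blast
  show "on_pair (A_coords \<epsilon>) ` A_deg d = jet_deg d"
  proof (cases rule: cs)
    case 1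
    have u: "on_pair (A_coords \<epsilon>) (A_pair [:r:] 0) = (r, 0, 0)" for r
      by (simp add: on_pair_A A_coords_def pderiv_pCons)
    then have "\<exists>r. (a, 0, 0) = on_pair (A_coords \<epsilon>) (A_pair [:r:] 0)" for a
      by simp
    then have "on_pair (A_coords \<epsilon>) ` A_deg 0 = {(a, 0, 0) | a. True}"
      unfolding 0 using u by blast
    then show ?thesis using 1 by (simp add: jet_deg_def)
  next
    case 2
    then show ?thesis by (simp only: j1) (simp add: jet_deg_def)
  next
    case 3
    then show ?thesis by (auto simp: 2 jet_deg_def on_pair_A A_coords_def)
  qed
qed

section \<open>Coordinates on the two presentations\<close>

lemma Qxy_eq: "Qxy = type_alg (\<lambda>r. Polynomial.smult [:r:])"
  by (simp add: Qxy_def type_alg_def)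

interpretation Qxy: rat_algebra_type "\<lambda>r. Polynomial.smult [:r:] :: rat poly poly \<Rightarrow> rat poly poly"
  by unfold_locales (simp_all add: smult_add_left[symmetric] smult_add_right one_pCons[symmetric] mult.commute)

lemma quotient_Qxy: "ideal I Qxy \<Longrightarrow> ideal_quotient (\<lambda>r. Polynomial.smult [:r:]) I"
  using Qxy.rat_algebra_type_axioms
  by (intro ideal_quotient.intro ideal_quotient_axioms.intro) (simp_all add: Qxy_eq)

lemma ideal_QxyI:
  assumes "0 \<in> I" "\<And>p q. p \<in> I \<Longrightarrow> q \<in> I \<Longrightarrow> p + q \<in> I" "\<And>p q. p \<in> I \<Longrightarrow> q * p \<in> I"
  shows "ideal I Qxy"
  unfolding Qxy_eq
proof (rule idealI)
  interpret ring "type_alg (\<lambda>r. Polynomial.smult [:r:] :: rat poly poly \<Rightarrow> _)" by (rule ring_type_alg)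
  have neg: "\<ominus>\<^bsub>type_alg (\<lambda>r. Polynomial.smult [:r:])\<^esub> p = - p" for p :: "rat poly poly"
    by (rule minus_equality) auto
  show "ring (type_alg (\<lambda>r. Polynomial.smult [:r:] :: rat poly poly \<Rightarrow> _))" by (rule ring_type_alg)
  show "subgroup I (add_monoid (type_alg (\<lambda>r. Polynomial.smult [:r:])))"
    using assms assms(3)[of _ "- 1"]
    by unfold_locales (auto simp: neg[unfolded a_inv_def, simplified])
qed (use assms(3) in \<open>auto simp: mult.commute\<close>)

lemma ideal_generated: "ideal (Idl\<^bsub>Qxy\<^esub> S) Qxy" and generator_mem: "x \<in> S \<Longrightarrow> x \<in> Idl\<^bsub>Qxy\<^esub> S"
  and generated_subset: "ideal I Qxy \<Longrightarrow> S \<subseteq> I \<Longrightarrow> Idl\<^bsub>Qxy\<^esub> S \<subseteq> I"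
proof -
  interpret ring Qxy unfolding Qxy_eq by (rule ring_type_alg)
  have c: "carrier Qxy = UNIV" by (simp add: Qxy_eq)
  show "ideal (Idl\<^bsub>Qxy\<^esub> S) Qxy" using genideal_ideal[of S] c by simp
  show "x \<in> S \<Longrightarrow> x \<in> Idl\<^bsub>Qxy\<^esub> S" using genideal_self[of S] c by auto
  show "ideal I Qxy \<Longrightarrow> S \<subseteq> I \<Longrightarrow> Idl\<^bsub>Qxy\<^esub> S \<subseteq> I" using genideal_minimal by blast
qed

definition plane_class :: "rat poly poly set \<Rightarrow> rat poly poly \<Rightarrow> rat poly poly set" where
  "plane_class I p = I +>\<^bsub>Qxy\<^esub> p"

context
  fixes I :: "rat poly poly set"
  assumes I: "ideal I Qxy"
begin

interpretation ideal_quotient "\<lambda>r. Polynomial.smult [:r:] :: rat poly poly \<Rightarrow> _" I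
  by (rule quotient_Qxy[OF I])

lemma Qxy_ideal_mem: "0 \<in> I" "p \<in> I \<Longrightarrow> q \<in> I \<Longrightarrow> p + q \<in> I" "p \<in> I \<Longrightarrow> q * p \<in> I" "p \<in> I \<Longrightarrow> q \<in> I \<Longrightarrow> p - q \<in> I"
  using I_zero I_add I_mult I_diff by auto

lemma in_plane_class: "x \<in> plane_class I p \<longleftrightarrow> x - p \<in> I"
  and plane_class_eq_iff: "plane_class I p = plane_class I q \<longleftrightarrow> p - q \<in> I"
  using coset_iff coset_eq_iff by (simp_all add: plane_class_def Qxy_eq)

lemma quot_Qxy_simps:
  "carrier (quot_alg Qxy I) = range (plane_class I)"
  "\<zero>\<^bsub>quot_alg Qxy I\<^esub> = plane_class I 0" "\<one>\<^bsub>quot_alg Qxy I\<^esub> = plane_class I 1"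
  "plane_class I p \<oplus>\<^bsub>quot_alg Qxy I\<^esub> plane_class I q = plane_class I (p + q)"
  "plane_class I p \<otimes>\<^bsub>quot_alg Qxy I\<^esub> plane_class I q = plane_class I (p * q)"
  "r \<odot>\<^bsub>quot_alg Qxy I\<^esub> plane_class I p = plane_class I (Polynomial.smult [:r:] p)"
  "plane_class I p [^]\<^bsub>quot_alg Qxy I\<^esub> (n::nat) = plane_class I (p ^ n)"
  using carrier_Q zero_Q one_Q add_Q mult_Q smult_Q pow_Q by (simp_all add: plane_class_def Qxy_eq)

lemma quot_Qxy_unit: "p * q - 1 \<in> I \<Longrightarrow> plane_class I p \<in> Units (quot_alg Qxy I)"
  using inverse_Q(1)[of p q] by (simp add: plane_class_def Qxy_eq)

lemma coordinates_quot:
  fixes T :: "(rat, 'b) module"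
  assumes T: "algebra rat_field T" "carrier T = UNIV"
    and add: "\<And>p q. c (p + q) = c p \<oplus>\<^bsub>T\<^esub> c q"
    and mult: "\<And>p q. c (p * q) = c p \<otimes>\<^bsub>T\<^esub> c q"
    and smult: "\<And>r p. c (Polynomial.smult [:r:] p) = r \<odot>\<^bsub>T\<^esub> c p"
    and one: "c 1 = \<one>\<^bsub>T\<^esub>"
    and ker: "\<And>p. p \<in> I \<longleftrightarrow> c p = \<zero>\<^bsub>T\<^esub>"
    and surj: "\<And>y. \<exists>p. c p = y"
  shows "the_elem (c ` plane_class I p) = c p"
    and "coordinates (quot_alg Qxy I) T (\<lambda>U. the_elem (c ` U))"
proof -
  interpret T: algebra rat_field T by (rule T(1))
  have diff: "p - q \<in> I \<longleftrightarrow> c p = c q" for p q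
  proof -
    have "c p = c (p - q) \<oplus>\<^bsub>T\<^esub> c q" using add[of "p - q" q] by simp
    then show ?thesis using T.M.add.l_cancel_one'[of "c q" "c (p - q)"]
      by (auto simp: ker T(2))
  qed
  have "p \<in> plane_class I p" for p by (simp add: in_plane_class Qxy_ideal_mem)
  then have "c ` plane_class I p = {c p}" for p by (auto simp: in_plane_class diff)
  then show eq: "the_elem (c ` plane_class I p) = c p" for p by simp
  show "coordinates (quot_alg Qxy I) T (\<lambda>U. the_elem (c ` U))"
  proof (rule coordinates.intro)
    show "algebra rat_field T" by (rule T(1))
    show "bij_betw (\<lambda>U. the_elem (c ` U)) (carrier (quot_alg Qxy I)) (carrier T)"
      unfolding bij_betw_def quot_Qxy_simps T(2)
    proof
      show "inj_on (\<lambda>U. the_elem (c ` U)) (range (plane_class I))"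
        by (auto intro!: inj_onI simp only: eq diff[symmetric] plane_class_eq_iff[symmetric])
      have "y \<in> (\<lambda>U. the_elem (c ` U)) ` range (plane_class I)" for y
        using surj[of y] eq by (metis rangeI image_eqI)
      then show "(\<lambda>U. the_elem (c ` U)) ` range (plane_class I) = UNIV" by blast
    qed
    have "c 0 \<oplus>\<^bsub>T\<^esub> c 0 = c 0" using add[of 0 0] by simp
    then have "c 0 = \<zero>\<^bsub>T\<^esub>" using T(2) T.M.add.l_cancel_one'[of "c 0" "c 0"] by simp
    then show "\<zero>\<^bsub>quot_alg Qxy I\<^esub> \<in> carrier (quot_alg Qxy I) \<and> the_elem (c ` \<zero>\<^bsub>quot_alg Qxy I\<^esub>) = \<zero>\<^bsub>T\<^esub>"
      by (simp add: quot_Qxy_simps eq)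
  qed (auto simp: quot_Qxy_simps eq add mult smult one)
qed

end

text \<open>
  Values and partial derivatives at the point \<open>V = a\<close>, \<open>W = b\<close>; the variable of the coefficients is \<open>V\<close>.
\<close>

definition ev :: "rat \<Rightarrow> rat \<Rightarrow> rat poly poly \<Rightarrow> rat" where
  "ev a b p = poly (poly p [:b:]) a"

definition dv :: "rat \<Rightarrow> rat \<Rightarrow> rat poly poly \<Rightarrow> rat" where
  "dv a b p = poly (pderiv (poly p [:b:])) a"

definition dw :: "rat \<Rightarrow> rat \<Rightarrow> rat poly poly \<Rightarrow> rat" where
  "dw a b p = ev a b (pderiv p)"

lemma ev_simps [simp]:
  "ev a b 0 = 0" "ev a b 1 = 1" "ev a b (p + q) = ev a b p + ev a b q" "ev a b (p - q) = ev a b p - ev a b q"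
  "ev a b (p * q) = ev a b p * ev a b q" "ev a b (p ^ n) = ev a b p ^ n"
  "ev a b (Polynomial.smult u p) = poly u a * ev a b p"
  "ev a b (pCons u p) = poly u a + b * ev a b p"
  by (simp_all add: ev_def poly_power)

lemma dv_simps [simp]:
  "dv a b 0 = 0" "dv a b 1 = 0" "dv a b (p + q) = dv a b p + dv a b q" "dv a b (p - q) = dv a b p - dv a b q"
  "dv a b (p * q) = dv a b p * ev a b q + ev a b p * dv a b q"
  "dv a b (Polynomial.smult u p) = poly (pderiv u) a * ev a b p + poly u a * dv a b p"
  "dv a b (pCons u p) = poly (pderiv u) a + b * dv a b p"
  by (simp_all add: dv_def ev_def pderiv_pCons pderiv_add pderiv_diff pderiv_mult pderiv_smult algebra_simps)

lemma dw_simps [simp]: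
  "dw a b 0 = 0" "dw a b 1 = 0" "dw a b (p + q) = dw a b p + dw a b q" "dw a b (p - q) = dw a b p - dw a b q"
  "dw a b (p * q) = dw a b p * ev a b q + ev a b p * dw a b q"
  "dw a b (Polynomial.smult u p) = poly u a * dw a b p"
  "dw a b (pCons u p) = ev a b p + b * dw a b p"
  by (simp_all add: dw_def pderiv_add pderiv_diff pderiv_mult pderiv_smult pderiv_pCons algebra_simps)

abbreviation const :: "rat \<Rightarrow> rat poly poly" where "const r \<equiv> [:[:r:]:]"

lemma const_hom: "const (a + b) = const a + const b" "const (a - b) = const a - const b"
    "const (- a) = - const a" "const 0 = 0"
  by simp_all

lemma poly_poly_induct:
  assumes const: "\<And>r. P (const r)" and add: "\<And>p q. P p \<Longrightarrow> P q \<Longrightarrow> P (p + q)"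
    and V: "\<And>p. P p \<Longrightarrow> P (V * p)" and W: "\<And>p. P p \<Longrightarrow> P (W * p)"
  shows "P p"
proof (induction p)
  case 0
  show ?case using const[of 0] by simp
next
  case (pCons q p)
  have "P [:q:]"
  proof (induction q)
    case 0
    show ?case using const[of 0] by simp
  next
    case (pCons r q)
    have "[:pCons r q:] = const r + V * [:q:]" by simp
    then show ?case using add[OF const V[OF pCons.IH]] by metis
  qed
  then have "P ([:q:] + W * p)" using W pCons.IH add by blast
  then show ?case by simp
qed

definition K_pres_coords :: "rat poly poly \<Rightarrow> rat \<times> rat \<times> rat \<times> rat \<times> rat" where
  "K_pres_coords p = (ev 1 1 p, dv 1 1 p, dw 1 1 p, ev (- 1) 1 p, ev (- 1) (- 1) p)"

definition A_pres_coords :: "rat poly poly \<Rightarrow> rat \<times> rat \<times> rat" where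
  "A_pres_coords p = (ev 0 0 p, dv 0 0 p, dw 0 0 p)"

lemma ideal_I_K: "ideal I_K Qxy"
  by (simp add: I_K_def ideal_generated)

lemma I_K_generators:
  "(W - 1) * (W ^ 2 - 1) \<in> I_K" "(V - 1) * (V ^ 2 - 1) \<in> I_K" "(V - W) * (W - 1) \<in> I_K"
  unfolding I_K_def by (rule generator_mem; simp)+

text \<open>
  Modulo \<open>I_K\<close> the five monomials \<open>1, V, V\<^sup>2, W, W\<^sup>2\<close> span everything, because their span is closed under
  multiplication by both variables: \<open>V\<^sup>3 = V\<^sup>2 + V - 1\<close>, likewise for \<open>W\<close>, and the third generator
  gives \<open>V W = V + W\<^sup>2 - W\<close>, from which \<open>V W\<^sup>2 = V + W\<^sup>2 - 1\<close> and \<open>V\<^sup>2 W = V\<^sup>2 + W - 1\<close>.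
\<close>

lemma I_K_normal_form:
  "\<exists>a b c d e. p - (const a + const b * V + const c * V ^ 2 + const d * W + const e * W ^ 2) \<in> I_K"
  (is "\<exists>a b c d e. p - ?n a b c d e \<in> I_K")
proof (induction p rule: poly_poly_induct)
  note mem = Qxy_ideal_mem(1-3)[OF ideal_I_K]
  {
    case (1 r)
    have "const r - ?n r 0 0 0 0 = 0" by simp
    then show ?case using mem(1) by metis
  next
    case (2 p q)
    then obtain a b c d e a' b' c' d' e' where "p - ?n a b c d e \<in> I_K" "q - ?n a' b' c' d' e' \<in> I_K" by blast
    then have sum: "(p - ?n a b c d e) + (q - ?n a' b' c' d' e') \<in> I_K" by (rule mem(2))
    have id: "p + q - ((a + a') + (b + b') * v + (c + c') * v^2 + (d + d') * w + (e + e') * w^2)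
        = (p - (a + b * v + c * v^2 + d * w + e * w^2)) + (q - (a' + b' * v + c' * v^2 + d' * w + e' * w^2))"
      for v w p q a b c d e a' b' c' d' e' :: "rat poly poly"
      by (simp add: algebra_simps)
    have "p + q - ?n (a + a') (b + b') (c + c') (d + d') (e + e') \<in> I_K"
      unfolding const_hom id by (rule sum)
    then show ?case by blast
  next
    case (3 p)
    then obtain a b c d e where p: "p - ?n a b c d e \<in> I_K" by blast
    have id: "v * p - ((- c - e) + (a + c + d + e) * v + (b + c) * v^2 + (- d) * w + (d + e) * w^2)
        = v * (p - (a + b * v + c * v^2 + d * w + e * w^2)) + (c * ((v - 1) * (v^2 - 1))
         + (d + e + e * w) * ((v - w) * (w - 1)) + e * ((w - 1) * (w^2 - 1)))"
      for v w p a b c d e :: "rat poly poly"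
      by (simp add: algebra_simps power2_eq_square)
    have "V * p - ?n (- c - e) (a + c + d + e) (b + c) (- d) (d + e) \<in> I_K"
      unfolding const_hom id by (intro mem p I_K_generators)
    then show ?case by blast
  next
    case (4 p)
    then obtain a b c d e where p: "p - ?n a b c d e \<in> I_K" by blast
    have id: "w * p - ((- c - e) + b * v + c * v^2 + (a - b + c + e) * w + (b + d + e) * w^2)
        = w * (p - (a + b * v + c * v^2 + d * w + e * w^2)) + ((c + e) * ((w - 1) * (w^2 - 1))
         + (b + c * v + c * w) * ((v - w) * (w - 1)))"
      for v w p a b c d e :: "rat poly poly"
      by (simp add: algebra_simps power2_eq_square)
    have "W * p - ?n (- c - e) b c (a - b + c + e) (b + d + e) \<in> I_K"
      unfolding const_hom id by (intro mem p I_K_generators)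
    then show ?case by blast
  }
qed

lemma K_pres_coords_hom:
  "K_pres_coords (p + q) = K_pres_coords p \<oplus>\<^bsub>jet_points_alg\<^esub> K_pres_coords q"
  "K_pres_coords (p * q) = K_pres_coords p \<otimes>\<^bsub>jet_points_alg\<^esub> K_pres_coords q"
  "K_pres_coords (Polynomial.smult [:r:] p) = r \<odot>\<^bsub>jet_points_alg\<^esub> K_pres_coords p"
  "K_pres_coords 1 = \<one>\<^bsub>jet_points_alg\<^esub>"
  by (simp_all add: K_pres_coords_def algebra_simps)

lemma A_pres_coords_hom:
  "A_pres_coords (p + q) = A_pres_coords p \<oplus>\<^bsub>jet_alg\<^esub> A_pres_coords q"
  "A_pres_coords (p * q) = A_pres_coords p \<otimes>\<^bsub>jet_alg\<^esub> A_pres_coords q"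
  "A_pres_coords (Polynomial.smult [:r:] p) = r \<odot>\<^bsub>jet_alg\<^esub> A_pres_coords p"
  "A_pres_coords 1 = \<one>\<^bsub>jet_alg\<^esub>"
  by (simp_all add: A_pres_coords_def algebra_simps)

text \<open>
  The coordinates vanish on the generators. Conversely they separate the five spanning monomials, so a
  polynomial with vanishing coordinates has normal form \<open>0\<close>.
\<close>

lemma I_K_kernel: "p \<in> I_K \<longleftrightarrow> K_pres_coords p = (0, 0, 0, 0, 0)"
proof -
  have "ideal {p. K_pres_coords p = (0, 0, 0, 0, 0)} Qxy"
    by (rule ideal_QxyI) (auto simp: K_pres_coords_def)
  moreover have "{(W - 1) * (W ^ 2 - 1), (V - 1) * (V ^ 2 - 1), (V - W) * (W - 1)} \<subseteq> {p. K_pres_coords p = (0, 0, 0, 0, 0)}"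
    by (simp add: K_pres_coords_def power2_eq_square)
  ultimately have sub: "K_pres_coords p = (0, 0, 0, 0, 0)" if "p \<in> I_K" for p
    using generated_subset that unfolding I_K_def by blast
  show ?thesis
  proof
    assume p: "K_pres_coords p = (0, 0, 0, 0, 0)"
    obtain a b c d e where n: "p - (const a + const b * V + const c * V ^ 2 + const d * W + const e * W ^ 2) \<in> I_K"
      using I_K_normal_form by blast
    have "K_pres_coords (const a + const b * V + const c * V ^ 2 + const d * W + const e * W ^ 2) = (0, 0, 0, 0, 0)"
      using sub[OF n] p by (simp add: K_pres_coords_def)
    then have "a = 0" "b = 0" "c = 0" "d = 0" "e = 0"
      by (simp_all add: K_pres_coords_def power2_eq_square pderiv_pCons)
    then show "p \<in> I_K" using n by simp
  qed (rule sub)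
qed

lemma K_pres_coords_surj: "\<exists>p. K_pres_coords p = y"
proof -
  obtain a b c d e where y: "y = (a, b, c, d, e)" by (cases y)
  have "\<exists>p0 p1 p2 p3 p4. p0 + p1 + p2 + p3 + p4 = a \<and> p1 + 2 * p2 = b \<and> p3 + 2 * p4 = c \<and>
     p0 - p1 + p2 + p3 + p4 = d \<and> p0 - p1 + p2 - p3 + p4 = e"
    \<comment> \<open>Differences of the equations give \<open>2 p\<^sub>1 = a - d\<close> and \<open>2 p\<^sub>3 = d - e\<close>; the rest is determined
      successively.\<close>
    apply (rule exI[of _ "(a + d) / 2 - (b - (a - d) / 2) / 2 - (d - e) / 2 - (c - (d - e) / 2) / 2"])
    apply (rule exI[of _ "(a - d) / 2"])
    apply (rule exI[of _ "(b - (a - d) / 2) / 2"])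
    apply (rule exI[of _ "(d - e) / 2"])
    apply (rule exI[of _ "(c - (d - e) / 2) / 2"])
    by (simp add: field_simps)
  then obtain p0 p1 p2 p3 p4 where "p0 + p1 + p2 + p3 + p4 = a" "p1 + 2 * p2 = b" "p3 + 2 * p4 = c"
     "p0 - p1 + p2 + p3 + p4 = d" "p0 - p1 + p2 - p3 + p4 = e" by blast
  then have "K_pres_coords (const p0 + const p1 * V + const p2 * V ^ 2 + const p3 * W + const p4 * W ^ 2) = y"
    by (simp add: K_pres_coords_def y power2_eq_square pderiv_pCons algebra_simps)
  then show ?thesis by blast
qed

lemma P_K_coords_class: "the_elem (K_pres_coords ` plane_class I_K p) = K_pres_coords p"
  and coordinates_P_K: "coordinates P_K jet_points_alg (\<lambda>U. the_elem (K_pres_coords ` U))"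
  unfolding P_K_def
  by (rule coordinates_quot[OF ideal_I_K algebra_jet_points, of K_pres_coords];
      simp add: K_pres_coords_hom I_K_kernel K_pres_coords_surj)+

lemma ideal_I_A: "ideal I_A Qxy"
proof -
  interpret ring Qxy unfolding Qxy_eq by (rule ring_type_alg)
  show ?thesis unfolding I_A_def by (intro ideal_prod_is_ideal ideal_generated)
qed

lemma I_A_generators: "V * V \<in> I_A" "V * W \<in> I_A" "W * V \<in> I_A" "W * W \<in> I_A"
proof -
  have "x * y \<in> I_A" if "x \<in> {V, W}" "y \<in> {V, W}" for x y
    using ideal_prod.prod[OF generator_mem[OF that(1)] generator_mem[OF that(2)], of Qxy]
    unfolding I_A_def by (simp add: Qxy_eq)
  then show "V * V \<in> I_A" "V * W \<in> I_A" "W * V \<in> I_A" "W * W \<in> I_A" by blast+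
qed

text \<open>
  Every monomial of degree at least \<open>2\<close> lies in \<open>I_A\<close>, so what remains is the first order Taylor
  polynomial at the origin.
\<close>

lemma I_A_normal_form: "p - (const (ev 0 0 p) + const (dv 0 0 p) * V + const (dw 0 0 p) * W) \<in> I_A"
  (is "p - ?n p \<in> _")
proof (induction p rule: poly_poly_induct)
  note mem = Qxy_ideal_mem(1-3)[OF ideal_I_A]
  {
    case (1 r)
    have "const r - ?n (const r) = 0" by simp
    then show ?case using mem(1) by metis
  next
    case (2 p q)
    have id: "p + q - ((a + a') + (b + b') * v + (c + c') * w)
        = (p - (a + b * v + c * w)) + (q - (a' + b' * v + c' * w))"
      for v w p q a b c a' b' c' :: "rat poly poly"
      by (simp add: algebra_simps)
    show ?case unfolding ev_simps dv_simps dw_simps const_hom id by (rule mem(2)[OF 2])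
  next
    case (3 p)
    have id: "v * p - (0 + a * v + 0 * w) = v * (p - (a + b * v + c * w)) + (b * (v * v) + c * (v * w))"
      for v w p a b c :: "rat poly poly"
      by (simp add: algebra_simps)
    have n: "?n (V * p) = 0 + const (ev 0 0 p) * V + 0 * W" by (simp add: pderiv_pCons)
    show ?case unfolding n id[of V p _ W "const (dv 0 0 p)" "const (dw 0 0 p)"]
      by (intro mem 3 I_A_generators)
  next
    case (4 p)
    have id: "w * p - (0 + 0 * v + a * w) = w * (p - (a + b * v + c * w)) + (b * (w * v) + c * (w * w))"
      for v w p a b c :: "rat poly poly"
      by (simp add: algebra_simps)
    have n: "?n (W * p) = 0 + 0 * V + const (ev 0 0 p) * W" by simp
    show ?case unfolding n id[of W p V _ "const (dv 0 0 p)" "const (dw 0 0 p)"]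
      by (intro mem 4 I_A_generators)
  }
qed

text \<open>
  In the nontrivial direction, a product of two polynomials that vanish at the origin vanishes there to second order.
\<close>

lemma I_A_kernel: "p \<in> I_A \<longleftrightarrow> A_pres_coords p = (0, 0, 0)"
proof
  assume "A_pres_coords p = (0, 0, 0)"
  then show "p \<in> I_A" using I_A_normal_form[of p] by (simp add: A_pres_coords_def)
next
  have "ideal {p. ev 0 0 p = 0} Qxy" by (rule ideal_QxyI) auto
  moreover have "{V, W} \<subseteq> {p. ev 0 0 p = 0}" by simp
  ultimately have van: "ev 0 0 q = 0" if "q \<in> Idl\<^bsub>Qxy\<^esub> {V, W}" for q
    using generated_subset that by blast
  assume "p \<in> I_A"
  then show "A_pres_coords p = (0, 0, 0)" unfolding I_A_def
    by (induction p rule: ideal_prod.induct) (auto simp: van Qxy_eq A_pres_coords_def)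
qed

lemma A_pres_coords_surj: "\<exists>p. A_pres_coords p = y"
proof -
  obtain a b c where y: "y = (a, b, c)" by (cases y)
  have "A_pres_coords (const a + const b * V + const c * W) = y" by (simp add: A_pres_coords_def y pderiv_pCons)
  then show ?thesis by blast
qed

lemma P_A_coords_class: "the_elem (A_pres_coords ` plane_class I_A p) = A_pres_coords p"
  and coordinates_P_A: "coordinates P_A jet_alg (\<lambda>U. the_elem (A_pres_coords ` U))"
  unfolding P_A_def
  by (rule coordinates_quot[OF ideal_I_A algebra_jet, of A_pres_coords];
      simp add: A_pres_coords_hom I_A_kernel A_pres_coords_surj)+

lemma subst_powers_0 [simp]: "subst_powers l 0 = 0"
  by (simp add: subst_powers_def)

lemma subst_powers_pCons:
  "subst_powers l (pCons q p) = [:pcompose q (monom 1 l):] + monom 1 l * subst_powers l p"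
proof (cases "p = 0 \<and> q = 0")
  case False
  then have "map_poly (\<lambda>q. pcompose q (monom 1 l)) (pCons q p) =
     pCons (pcompose q (monom 1 l)) (map_poly (\<lambda>q. pcompose q (monom 1 l)) p)"
    by (intro map_poly_pCons) auto
  then show ?thesis by (simp add: subst_powers_def pcompose_pCons)
qed simp

lemma ev_monom: "ev a b (monom 1 l) = b ^ l" "dv a b (monom 1 l) = 0" "dw 1 1 (monom 1 l) = of_nat l"
proof -
  have "poly (monom 1 l) [:b:] = [:b ^ l:]" by (simp add: poly_monom poly_const_pow)
  then show "ev a b (monom 1 l) = b ^ l" "dv a b (monom 1 l) = 0"
    by (simp_all add: ev_def dv_def pderiv_pCons)
  show "dw 1 1 (monom 1 l) = of_nat l"
    by (simp add: dw_def ev_def pderiv_monom poly_monom flip: one_pCons)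
qed

lemma ev_subst_powers: "ev a b (subst_powers l p) = ev (a ^ l) (b ^ l) p"
  by (induction p) (simp_all add: subst_powers_pCons ev_monom poly_pcompose poly_monom)

text \<open>
  The chain rule, where \<open>l\<close> is the derivative of the \<open>l\<close>-th power at \<open>1\<close>.
\<close>

lemma dv_subst_powers: "dv 1 1 (subst_powers l p) = of_nat l * dv 1 1 p"
  by (induction p)
    (simp_all add: subst_powers_pCons ev_monom poly_pcompose poly_monom pderiv_pcompose pderiv_monom algebra_simps)

lemma dw_subst_powers: "dw 1 1 (subst_powers l p) = of_nat l * dw 1 1 p"
  by (induction p) (simp_all add: subst_powers_pCons ev_monom ev_subst_powers algebra_simps)

lemma K_pres_coords_subst_powers: "K_pres_coords (subst_powers l p) = psi_points l (K_pres_coords p)"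
  by (auto simp: K_pres_coords_def psi_points_def ev_subst_powers dv_subst_powers dw_subst_powers)

text \<open>
  The substitution \<open>p \<mapsto> subst_powers l p\<close> respects \<open>I_K\<close> because it acts on the coordinates.
\<close>

lemma P_adams_class: "P_adams l (plane_class I_K p) = plane_class I_K (subst_powers l p)"
proof -
  have "plane_class I_K (subst_powers l q) = plane_class I_K (subst_powers l p)" if "q \<in> plane_class I_K p" for q
  proof -
    have "plane_class I_K q = plane_class I_K p" using that by (simp add: in_plane_class[OF ideal_I_K] plane_class_eq_iff[OF ideal_I_K])
    then have "K_pres_coords q = K_pres_coords p" by (metis P_K_coords_class)
    then have "K_pres_coords (subst_powers l q) = K_pres_coords (subst_powers l p)"
      by (simp add: K_pres_coords_subst_powers)
    then show ?thesis
      using coordinates.eqI[OF coordinates_P_K, of "plane_class I_K (subst_powers l q)" "plane_class I_K (subst_powers l p)"]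
      by (simp add: P_K_coords_class P_K_def quot_Qxy_simps[OF ideal_I_K])
  qed
  moreover have "p \<in> plane_class I_K p" by (simp add: in_plane_class[OF ideal_I_K] Qxy_ideal_mem[OF ideal_I_K])
  ultimately show ?thesis unfolding P_adams_def plane_class_def[symmetric] by blast
qed

lemma A_pres_coords_coeff:
  "A_pres_coords p = (coeff (coeff p 0) 0, coeff (coeff p 0) 1, coeff (coeff p 1) 0)"
proof -
  have "poly q [:0:] = coeff q 0" for q :: "rat poly poly" by (simp add: poly_0_coeff_0)
  then show ?thesis
    by (simp add: A_pres_coords_def ev_def dv_def dw_def poly_0_coeff_0 coeff_pderiv)
qed

lemma P_A_deg_coords:
  "P_A_deg d \<subseteq> carrier P_A" "(\<lambda>U. the_elem (A_pres_coords ` U)) ` P_A_deg d = jet_deg d"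
proof -
  define hom where "hom = {p :: rat poly poly. \<forall>i j. coeff (coeff p j) i \<noteq> 0 \<longrightarrow> i + j = d}"
  have P: "P_A_deg d = plane_class I_A ` hom" by (auto simp: P_A_deg_def plane_class_def hom_def)
  show "P_A_deg d \<subseteq> carrier P_A"
    unfolding P P_A_def quot_Qxy_simps[OF ideal_I_A] by blast
  have "A_pres_coords ` hom = jet_deg d"
  proof (intro equalityI subsetI)
    fix y assume "y \<in> A_pres_coords ` hom"
    then show "y \<in> jet_deg d" by (force simp: hom_def A_pres_coords_coeff jet_deg_def)
  next
    fix y assume y: "y \<in> jet_deg d"
    consider "d = 0" | "d = 1" | "d \<noteq> 0" "d \<noteq> 1" by blast
    then show "y \<in> A_pres_coords ` hom"
    proof cases
      case 1
      then obtain a where "y = (a, 0, 0)" using y by (auto simp: jet_deg_def)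
      then have "y = A_pres_coords (const a)" by (simp add: A_pres_coords_coeff)
      moreover have "const a \<in> hom" using 1 by (auto simp: hom_def coeff_pCons split: nat.splits)
      ultimately show ?thesis by blast
    next
      case 2
      then obtain b c where "y = (0, b, c)" using y by (auto simp: jet_deg_def)
      then have "y = A_pres_coords [:[:0, b:], [:c:]:]" by (simp add: A_pres_coords_coeff)
      moreover have "[:[:0, b:], [:c:]:] \<in> hom" using 2 by (auto simp: hom_def coeff_pCons split: nat.splits)
      ultimately show ?thesis by blast
    next
      case 3
      then have "y = A_pres_coords 0" using y by (simp add: jet_deg_def A_pres_coords_coeff)
      moreover have "0 \<in> hom" by (simp add: hom_def)
      ultimately show ?thesis by blast
    qed
  qed
  then show "(\<lambda>U. the_elem (A_pres_coords ` U)) ` P_A_deg d = jet_deg d"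
    by (simp add: P image_image P_A_coords_class)
qed

section \<open>The isomorphisms\<close>

lemma P_K_simps:
  "carrier P_K = range (plane_class I_K)" "\<one>\<^bsub>P_K\<^esub> = plane_class I_K 1" "\<sigma> = plane_class I_K V" "\<tau> = plane_class I_K W"
  "plane_class I_K p [^]\<^bsub>P_K\<^esub> (n::nat) = plane_class I_K (p ^ n)"
  by (simp_all add: P_K_def quot_Qxy_simps[OF ideal_I_K] \<sigma>_def \<tau>_def plane_class_def[symmetric])

lemma P_A_simps:
  "carrier P_A = range (plane_class I_A)" "\<zero>\<^bsub>P_A\<^esub> = plane_class I_A 0" "\<one>\<^bsub>P_A\<^esub> = plane_class I_A 1"
  "\<mu> = plane_class I_A V" "\<nu> = plane_class I_A W"
  "plane_class I_A p \<oplus>\<^bsub>P_A\<^esub> plane_class I_A q = plane_class I_A (p + q)"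
  "plane_class I_A p [^]\<^bsub>P_A\<^esub> (n::nat) = plane_class I_A (p ^ n)"
  by (simp_all add: P_A_def quot_Qxy_simps[OF ideal_I_A] \<mu>_def \<nu>_def plane_class_def[symmetric])

definition P_K_map where "P_K_map U = the_elem (K_pres_coords ` U)"
definition P_A_map where "P_A_map U = the_elem (A_pres_coords ` U)"
definition K_map where "K_map \<epsilon> = on_pair (K_coords \<epsilon>)"
definition A_map where "A_map \<epsilon> = on_pair (A_coords \<epsilon>)"

lemma coordinate_systems:
  "coordinates P_K jet_points_alg P_K_map"
  "coordinates P_A jet_alg P_A_map"
  "\<epsilon> \<in> {1, - 1} \<Longrightarrow> coordinates K_virt jet_points_alg (K_map \<epsilon>)"
  "\<epsilon> \<in> {1, - 1} \<Longrightarrow> coordinates A_virt jet_alg (A_map \<epsilon>)"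
  using coordinates_P_K coordinates_P_A coordinates_K coordinates_A
  by (simp_all add: P_K_map_def[abs_def] P_A_map_def[abs_def] K_map_def A_map_def)

lemma coordinate_maps:
  "P_K_map (plane_class I_K p) = K_pres_coords p" "P_A_map (plane_class I_A p) = A_pres_coords p"
  "K_map \<epsilon> (K_pair f g) = K_coords \<epsilon> f g" "A_map \<epsilon> (A_pair f g) = A_coords \<epsilon> f g"
  by (simp_all add: P_K_map_def P_A_map_def K_map_def A_map_def P_K_coords_class P_A_coords_class on_pair_K on_pair_A)

text \<open>
  These are the maps \<open>\<Phi>\<close>, \<open>\<Psi>\<close> and \<open>\<theta>\<close> of the theorem: match the coordinates of both sides and, for the
  Chern character, keep only the jet.
\<close>

definition K_iso where "K_iso \<epsilon> = inv_into (carrier K_virt) (K_map \<epsilon>) \<circ> P_K_map"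
definition A_iso where "A_iso \<epsilon> = inv_into (carrier A_virt) (A_map \<epsilon>) \<circ> P_A_map"
definition Ch_pres where "Ch_pres = inv_into (carrier P_A) P_A_map \<circ> (jet_of_points \<circ> P_K_map)"

lemma inverse_coords:
  assumes "coordinates A T h" "carrier T = UNIV"
  shows "inv_into (carrier A) h y \<in> carrier A" "h (inv_into (carrier A) h y) = y"
  using coordinates.bij[OF assms(1)] assms(2)
  by (metis UNIV_I bij_betw_imp_surj_on inv_into_into, metis UNIV_I bij_betw_imp_surj_on f_inv_into_f)

lemma inverse_coords_eqI:
  assumes "coordinates A T h" "x \<in> carrier A" "h x = y"
  shows "inv_into (carrier A) h y = x"
  using coordinates.bij[OF assms(1)] assms(2,3) by (auto simp: bij_betw_def)

lemma psi_ring_iso_coords: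
  "psi_ring_iso P_K P_adams jet_points_alg psi_points P_K_map"
  "\<epsilon> \<in> {1, - 1} \<Longrightarrow> psi_ring_iso K_virt K_adams jet_points_alg psi_points (K_map \<epsilon>)"
proof -
  show "psi_ring_iso P_K P_adams jet_points_alg psi_points P_K_map"
    by (rule coordinates.psi_ring_iso[OF coordinate_systems(1) psi_ring_points])
      (auto simp: P_K_simps P_adams_class coordinate_maps K_pres_coords_subst_powers)
  show "psi_ring_iso K_virt K_adams jet_points_alg psi_points (K_map \<epsilon>)" if "\<epsilon> \<in> {1, - 1}"
    by (rule coordinates.psi_ring_iso[OF coordinate_systems(3)[OF that] psi_ring_points])
      (simp add: K_adams_coords K_map_def)
qed

lemma graded_iso_coords:
  "graded_alg_iso P_A P_A_deg jet_alg jet_deg P_A_map"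
  "\<epsilon> \<in> {1, - 1} \<Longrightarrow> graded_alg_iso A_virt A_deg jet_alg jet_deg (A_map \<epsilon>)"
proof -
  show "graded_alg_iso P_A P_A_deg jet_alg jet_deg P_A_map"
    by (rule coordinates.graded_iso(1)[OF coordinate_systems(2) graded_jet])
      (simp_all add: P_A_deg_coords P_A_map_def[abs_def])
  show "graded_alg_iso A_virt A_deg jet_alg jet_deg (A_map \<epsilon>)" if "\<epsilon> \<in> {1, - 1}"
    by (rule coordinates.graded_iso(1)[OF coordinate_systems(4)[OF that] graded_jet])
      (use A_deg_coords[OF that] in \<open>simp_all add: A_map_def\<close>)
qed

lemma K_iso_iso:
  assumes "\<epsilon> \<in> {1, - 1}"
  shows "alg_iso P_K K_virt (K_iso \<epsilon>)" "psi_ring_iso P_K P_adams K_virt K_adams (K_iso \<epsilon>)"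
  unfolding K_iso_def
  by (rule alg_iso_trans[OF coordinates.iso[OF coordinate_systems(1)] alg_iso_inv[OF coordinates.iso[OF coordinate_systems(3)[OF assms]]]],
    rule psi_ring_iso_trans[OF psi_ring_iso_coords(1) psi_ring_iso_inv[OF psi_ring_iso_coords(2)[OF assms]]])

lemma A_iso_iso:
  assumes "\<epsilon> \<in> {1, - 1}"
  shows "graded_alg_iso P_A P_A_deg A_virt A_deg (A_iso \<epsilon>)"
  unfolding A_iso_def
  by (rule graded_alg_iso_trans[OF graded_iso_coords(1) graded_alg_iso_inv[OF graded_iso_coords(2)[OF assms]]])

lemma Ch_pres_hom: "Ch_pres \<in> alg_hom P_K P_A"
  unfolding Ch_pres_def
  using coordinates.iso[OF coordinate_systems(1)] alg_iso_inv[OF coordinates.iso[OF coordinate_systems(2)]]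
  by (intro alg_hom_trans[OF alg_hom_trans[OF _ jet_of_points_hom]]) (auto simp: alg_iso_def)

lemma Ch_K_iso:
  assumes "\<epsilon> \<in> {1, - 1}"
  shows "Ch (K_iso \<epsilon> u) = A_iso \<epsilon> (Ch_pres u)"
proof -
  have K: "K_iso \<epsilon> u \<in> carrier K_virt" "K_map \<epsilon> (K_iso \<epsilon> u) = P_K_map u"
    using inverse_coords[OF coordinate_systems(3)[OF assms]] by (simp_all add: K_iso_def)
  have "P_A_map (Ch_pres u) = jet_of_points (P_K_map u)"
    using inverse_coords[OF coordinate_systems(2)] by (simp add: Ch_pres_def)
  also have "\<dots> = A_map \<epsilon> (Ch (K_iso \<epsilon> u))"
    using Ch_coords(2)[OF K(1), of \<epsilon>] K(2) by (simp add: A_map_def K_map_def)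
  finally show ?thesis
    using inverse_coords_eqI[OF coordinate_systems(4)[OF assms] Ch_coords(1)[OF K(1)]] by (simp add: A_iso_def)
qed

text \<open>
  In coordinates, the first inertial Chern class is the linear part of the jet at \<open>(1, 1)\<close>.
\<close>

lemma ctilde1_eqI:
  assumes "\<epsilon> \<in> {1, - 1}" "u \<in> carrier K_virt" "K_map \<epsilon> u = (a, b, c, d, e)"
    and "v \<in> carrier A_virt" "A_map \<epsilon> v = (0, b, c)"
  shows "ctilde1 u = v"
proof -
  note A = coordinate_systems(4)[OF assms(1)]
  have C: "Ch u \<in> carrier A_virt" "A_map \<epsilon> (Ch u) = (a, b, c)"
    using Ch_coords[OF assms(2)] assms(3) by (simp_all add: A_map_def K_map_def jet_of_points_def)
  have "ctilde1 u \<in> carrier A_virt \<and> A_map \<epsilon> (ctilde1 u) = degree_part jet_alg jet_deg 1 (A_map \<epsilon> (Ch u))"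
    unfolding ctilde1_def
    by (rule coordinates.graded_iso(2)[OF A graded_jet])
      (use A_deg_coords[OF assms(1)] C(1) in \<open>simp_all add: A_map_def\<close>)
  then show ?thesis
    using coordinates.eqI[OF A _ assms(4), of "ctilde1 u"] C(2) assms(5) by (simp add: degree_part_jet[unfolded One_nat_def])
qed

lemma chi0_1: "chi0 1 = K_pair X 0"
  using chi0_int[of 1] by (simp add: monom_X)

lemma tau_img_eq: "tau_img \<epsilon> = K_pair [:1 / 2, 1 / 2:] [:\<epsilon> / 2:]"
  using chi0_int[of 0] chi1_int[of 0] by (simp add: tau_img_def chi0_1 K_virt_simps one_pCons)

lemma half_sum_eq: "(1 / 2) \<odot>\<^bsub>A_virt\<^esub> (c0 1 \<oplus>\<^bsub>A_virt\<^esub> \<epsilon> \<odot>\<^bsub>A_virt\<^esub> c1 0) = A_pair [:0, 1 / 2:] [:\<epsilon> / 2:]"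
  by (simp add: c_low A_virt_simps one_pCons)

text \<open>
  The value and derivatives at \<open>(1, 1)\<close> and the values at \<open>(-1, 1)\<close>, \<open>(-1, -1)\<close> of the two coordinate
  functions of the plane, found on both sides.
\<close>

lemma generator_coords:
  assumes "\<epsilon> \<in> {1, - 1}"
  shows "K_map \<epsilon> (chi0 1) = (1, 1, 0, - 1, - 1)" "K_map \<epsilon> (tau_img \<epsilon>) = (1, 0, 1, 1, - 1)"
    "P_K_map \<sigma> = (1, 1, 0, - 1, - 1)" "P_K_map \<tau> = (1, 0, 1, 1, - 1)"
    "A_map \<epsilon> (c0 1) = (0, 1, 0)" "A_map \<epsilon> (A_pair [:0, 1 / 2:] [:\<epsilon> / 2:]) = (0, 0, 1)"
    "P_A_map \<mu> = (0, 1, 0)" "P_A_map \<nu> = (0, 0, 1)"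
  using assms
  by (auto simp: chi0_1 tau_img_eq P_K_simps P_A_simps c_low coordinate_maps K_coords_def A_coords_def
      K_pres_coords_def A_pres_coords_def pderiv_pCons)

lemma generator_carrier:
  "chi0 1 \<in> carrier K_virt" "tau_img \<epsilon> \<in> carrier K_virt" "c0 1 \<in> carrier A_virt" "A_pair f g \<in> carrier A_virt"
  by (auto simp: chi0_1 tau_img_eq c_low K_virt_simps A_virt_simps)

lemma K_iso_generators:
  assumes "\<epsilon> \<in> {1, - 1}"
  shows "K_iso \<epsilon> \<sigma> = chi0 1" "K_iso \<epsilon> \<tau> = tau_img \<epsilon>"
  using inverse_coords_eqI[OF coordinate_systems(3)[OF assms]] generator_coords[OF assms] generator_carrier
  by (simp_all add: K_iso_def)

lemma A_iso_generators:
  assumes "\<epsilon> \<in> {1, - 1}"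
  shows "A_iso \<epsilon> \<mu> = c0 1" "A_iso \<epsilon> \<nu> = A_pair [:0, 1 / 2:] [:\<epsilon> / 2:]"
  using inverse_coords_eqI[OF coordinate_systems(4)[OF assms]] generator_coords[OF assms] generator_carrier
  by (simp_all add: A_iso_def)

lemma ctilde1_generators:
  assumes "\<epsilon> \<in> {1, - 1}"
  shows "ctilde1 (chi0 1) = c0 1" "ctilde1 (tau_img \<epsilon>) = A_pair [:0, 1 / 2:] [:\<epsilon> / 2:]"
  by (rule ctilde1_eqI[OF assms generator_carrier(1) generator_coords(1)[OF assms] generator_carrier(3) generator_coords(5)[OF assms]])
    (rule ctilde1_eqI[OF assms generator_carrier(2) generator_coords(2)[OF assms] generator_carrier(4) generator_coords(6)[OF assms]])

lemma signs_differ: "tau_img 1 \<noteq> tau_img (- 1)" "A_pair [:0, 1 / 2:] [:1 / 2:] \<noteq> A_pair [:0, 1 / 2:] [:- 1 / 2:]"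
proof -
  have "K_map 1 (tau_img 1) \<noteq> K_map 1 (tau_img (- 1))"
    by (simp add: tau_img_eq coordinate_maps K_coords_def)
  then show "tau_img 1 \<noteq> tau_img (- 1)" by metis
  have "A_map 1 (A_pair [:0, 1 / 2:] [:1 / 2:]) \<noteq> A_map 1 (A_pair [:0, 1 / 2:] [:- 1 / 2:])"
    by (simp add: coordinate_maps A_coords_def)
  then show "A_pair [:0, 1 / 2:] [:1 / 2:] \<noteq> A_pair [:0, 1 / 2:] [:- 1 / 2:]" by metis
qed

lemma Ch_pres_eqI: "x \<in> carrier P_A \<Longrightarrow> P_A_map x = jet_of_points (P_K_map u) \<Longrightarrow> Ch_pres u = x"
  unfolding Ch_pres_def using inverse_coords_eqI[OF coordinate_systems(2)] by simp

lemma Ch_pres_generators: "Ch_pres \<sigma> = \<one>\<^bsub>P_A\<^esub> \<oplus>\<^bsub>P_A\<^esub> \<mu>" "Ch_pres \<tau> = \<one>\<^bsub>P_A\<^esub> \<oplus>\<^bsub>P_A\<^esub> \<nu>"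
  by (rule Ch_pres_eqI; simp add: P_A_simps P_K_simps coordinate_maps K_pres_coords_def A_pres_coords_def jet_of_points_def pderiv_pCons)+

lemma alg_exp_square_zero:
  assumes A: "algebra rat_field A" and x: "x \<in> carrier A" "x \<noteq> \<zero>\<^bsub>A\<^esub>" "x \<otimes>\<^bsub>A\<^esub> x = \<zero>\<^bsub>A\<^esub>" "\<one>\<^bsub>A\<^esub> \<noteq> \<zero>\<^bsub>A\<^esub>"
  shows "alg_exp A x = \<one>\<^bsub>A\<^esub> \<oplus>\<^bsub>A\<^esub> x"
proof -
  interpret algebra rat_field A by (rule A)
  have "x [^]\<^bsub>A\<^esub> (n + 2) = \<zero>\<^bsub>A\<^esub>" for n :: nat
    by (induction n) (use x in \<open>simp_all add: numeral_2_eq_2\<close>)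
  then have "x [^]\<^bsub>A\<^esub> n = \<zero>\<^bsub>A\<^esub>" if "n \<notin> {0, 1}" for n :: nat
    using that by (metis One_nat_def add_2_eq_Suc' insertCI nat.exhaust)
  then have "{n::nat. x [^]\<^bsub>A\<^esub> n \<noteq> \<zero>\<^bsub>A\<^esub>} = {0, 1}" using x by auto
  then show ?thesis using x smult_one by (simp add: alg_exp_def)
qed

lemma alg_exp_generators: "alg_exp P_A \<mu> = \<one>\<^bsub>P_A\<^esub> \<oplus>\<^bsub>P_A\<^esub> \<mu>" "alg_exp P_A \<nu> = \<one>\<^bsub>P_A\<^esub> \<oplus>\<^bsub>P_A\<^esub> \<nu>"
proof -
  interpret coordinates P_A jet_alg P_A_map by (rule coordinate_systems(2))
  have z: "P_A_map \<zero>\<^bsub>P_A\<^esub> = (0, 0, 0)" and o: "P_A_map \<one>\<^bsub>P_A\<^esub> = (1, 0, 0)"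
    using zero one by simp_all
  have "alg_exp P_A x = \<one>\<^bsub>P_A\<^esub> \<oplus>\<^bsub>P_A\<^esub> x" if "x \<in> carrier P_A" "P_A_map x = (0, b, c)" "(b, c) \<noteq> (0, 0)" for x b c
  proof (rule alg_exp_square_zero[OF algebra_A that(1)])
    show "x \<noteq> \<zero>\<^bsub>P_A\<^esub>" "\<one>\<^bsub>P_A\<^esub> \<noteq> \<zero>\<^bsub>P_A\<^esub>" using z o that by auto
    show "x \<otimes>\<^bsub>P_A\<^esub> x = \<zero>\<^bsub>P_A\<^esub>" using that mult[OF that(1,1)] zero by (intro eqI) auto
  qed
  moreover have "\<mu> \<in> carrier P_A" "\<nu> \<in> carrier P_A" by (simp_all add: P_A_simps)
  ultimately show "alg_exp P_A \<mu> = \<one>\<^bsub>P_A\<^esub> \<oplus>\<^bsub>P_A\<^esub> \<mu>" "alg_exp P_A \<nu> = \<one>\<^bsub>P_A\<^esub> \<oplus>\<^bsub>P_A\<^esub> \<nu>"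
    using generator_coords(7,8)[of 1] by auto
qed

text \<open>
  Both generators satisfy the cubic relation of \<open>x0\<close> and are inverted by the same formula.
\<close>

lemma generator_units: "\<sigma> \<in> Units P_K" "\<tau> \<in> Units P_K"
  unfolding P_K_simps(3,4) P_K_def
  by (rule quot_Qxy_unit[OF ideal_I_K, of _ "1 + V - V ^ 2"] quot_Qxy_unit[OF ideal_I_K, of _ "1 + W - W ^ 2"];
      simp add: I_K_kernel K_pres_coords_def power2_eq_square pderiv_pCons)+

lemma P_adams_generators: "P_adams l \<sigma> = \<sigma> [^]\<^bsub>P_K\<^esub> l" "P_adams l \<tau> = \<tau> [^]\<^bsub>P_K\<^esub> l"
proof -
  have "subst_powers l 1 = 1"
    using subst_powers_pCons[of l 1 0] by (simp add: pcompose_1 flip: one_pCons)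
  then have "subst_powers l V = V ^ l" "subst_powers l W = W ^ l"
    by (simp_all add: subst_powers_pCons pcompose_pCons pcompose_1 monom_altdef poly_const_pow)
  then show "P_adams l \<sigma> = \<sigma> [^]\<^bsub>P_K\<^esub> l" "P_adams l \<tau> = \<tau> [^]\<^bsub>P_K\<^esub> l"
    by (simp_all only: P_K_simps P_adams_class)
qed

lemma psi_unit_power:
  assumes psi: "psi_ring R \<psi>" and x: "x \<in> Units R" "\<psi> l x = x [^]\<^bsub>R\<^esub> l" and l: "l \<ge> 1" and s: "s \<in> {1, - 1 :: int}"
  shows "\<psi> l (x [^]\<^bsub>R\<^esub> s) = x [^]\<^bsub>R\<^esub> (s * int l)"
proof -
  interpret cring R using psi by (simp add: psi_ring_def)
  have hom: "\<psi> l \<in> ring_hom R R" using psi l by (simp add: psi_ring_def)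
  have c: "x \<in> carrier R" "inv\<^bsub>R\<^esub> x \<in> carrier R" using x(1) by auto
  have "x [^]\<^bsub>R\<^esub> l \<otimes>\<^bsub>R\<^esub> \<psi> l (inv\<^bsub>R\<^esub> x) = \<psi> l (x \<otimes>\<^bsub>R\<^esub> inv\<^bsub>R\<^esub> x)"
    using ring_hom_mult[OF hom c] x(2) by simp
  also have "\<dots> = \<one>\<^bsub>R\<^esub>" using x(1) ring_hom_one[OF hom] by simp
  finally have "inv\<^bsub>R\<^esub> (x [^]\<^bsub>R\<^esub> l) = \<psi> l (inv\<^bsub>R\<^esub> x)"
    using c ring_hom_closed[OF hom c(2)] by (intro comm_inv_char) auto
  moreover have "x [^]\<^bsub>R\<^esub> (- 1 :: int) = inv\<^bsub>R\<^esub> x" "x [^]\<^bsub>R\<^esub> (1 :: int) = x"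
    using c by (simp_all add: int_pow_def2)
  moreover have "x [^]\<^bsub>R\<^esub> (- int l) = inv\<^bsub>R\<^esub> (x [^]\<^bsub>R\<^esub> l)"
    using l by (simp add: int_pow_def2)
  ultimately show ?thesis using s x(2) by (elim insertE) (simp_all add: int_pow_int)
qed

theorem proposition7p19:
  shows "\<exists>(\<Phi> :: rat \<Rightarrow> rat poly poly set \<Rightarrow> rat poly set \<times> rat poly set)
      (\<Psi> :: rat \<Rightarrow> rat poly poly set \<Rightarrow> rat poly set \<times> rat poly set)
      (\<theta> :: rat poly poly set \<Rightarrow> rat poly poly set).
    \<comment> \<open>the \<open>\<psi>\<close>-structure on the domain\<close>
    \<sigma> \<in> Units P_K \<and> \<tau> \<in> Units P_K \<and>
    (\<forall>l\<ge>1. \<forall>s\<in>{1, - 1 :: int}.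
       P_adams l (\<sigma> [^]\<^bsub>P_K\<^esub> s) = \<sigma> [^]\<^bsub>P_K\<^esub> (s * int l) \<and>
       P_adams l (\<tau> [^]\<^bsub>P_K\<^esub> s) = \<tau> [^]\<^bsub>P_K\<^esub> (s * int l)) \<and>
    \<comment> \<open>the isomorphisms\<close>
    (\<forall>\<epsilon>\<in>{1, - 1}.
       alg_iso P_K K_virt (\<Phi> \<epsilon>) \<and>
       psi_ring_iso P_K P_adams K_virt K_adams (\<Phi> \<epsilon>) \<and>
       \<Phi> \<epsilon> \<sigma> = chi0 1 \<and>
       \<Phi> \<epsilon> \<tau> = tau_img \<epsilon> \<and>
       graded_alg_iso P_A P_A_deg A_virt A_deg (\<Psi> \<epsilon>) \<and>
       \<Psi> \<epsilon> \<nu> = ctilde1 (tau_img \<epsilon>) \<and>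
       ctilde1 (tau_img \<epsilon>) = (1 / 2) \<odot>\<^bsub>A_virt\<^esub> (c0 1 \<oplus>\<^bsub>A_virt\<^esub> \<epsilon> \<odot>\<^bsub>A_virt\<^esub> c1 0) \<and>
       \<Psi> \<epsilon> \<mu> = ctilde1 (chi0 1) \<and>
       ctilde1 (chi0 1) = c0 1) \<and>
    \<comment> \<open>the two signs give different isomorphisms\<close>
    \<Phi> 1 \<tau> \<noteq> \<Phi> (- 1) \<tau> \<and> \<Psi> 1 \<nu> \<noteq> \<Psi> (- 1) \<nu> \<and>
    \<comment> \<open>the Chern character\<close>
    \<theta> \<in> alg_hom P_K P_A \<and>
    \<theta> \<sigma> = alg_exp P_A \<mu> \<and> alg_exp P_A \<mu> = \<one>\<^bsub>P_A\<^esub> \<oplus>\<^bsub>P_A\<^esub> \<mu> \<and>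
    \<theta> \<tau> = alg_exp P_A \<nu> \<and> alg_exp P_A \<nu> = \<one>\<^bsub>P_A\<^esub> \<oplus>\<^bsub>P_A\<^esub> \<nu> \<and>
    (\<forall>\<epsilon>\<in>{1, - 1}. \<forall>u\<in>carrier P_K. Ch (\<Phi> \<epsilon> u) = \<Psi> \<epsilon> (\<theta> u))"
proof (rule exI[of _ K_iso], rule exI[of _ A_iso], rule exI[of _ Ch_pres], intro conjI ballI allI impI)
  have psi: "psi_ring P_K P_adams" using psi_ring_iso_coords(1) by (simp add: psi_ring_iso_def)
  show "P_adams l (\<sigma> [^]\<^bsub>P_K\<^esub> s) = \<sigma> [^]\<^bsub>P_K\<^esub> (s * int l)" "P_adams l (\<tau> [^]\<^bsub>P_K\<^esub> s) = \<tau> [^]\<^bsub>P_K\<^esub> (s * int l)"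
    if "1 \<le> l" "s \<in> {1, - 1}" for l s
    using psi_unit_power[OF psi generator_units(1) P_adams_generators(1) that]
      psi_unit_power[OF psi generator_units(2) P_adams_generators(2) that] .
qed (simp_all only: generator_units K_iso_iso A_iso_iso K_iso_generators A_iso_generators ctilde1_generators half_sum_eq
    Ch_pres_hom Ch_pres_generators alg_exp_generators Ch_K_iso, insert signs_differ, simp_all add: K_iso_generators A_iso_generators)

end
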